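(* Assume that $f_i$ is convex and $L$-smooth for all $i=1,\dots,n$ and $f$ is $\mu$-quasi strongly convex, $\mu\ge0$. Consider EC-GDstar with $0<\gamma\le\frac{\delta}{8L\sqrt3}$. Then EC-GDstar satisfies the parametric assumption of the context with $A=A'=L$, $\widetilde A=0$, $B_1=B_2=\widetilde B_1=\widetilde B_2=B_1'=B_2'=0$, $D_1=\widetilde D_1=D_1'=0$, $\sigma_{1,k}^2\equiv\sigma_{2,k}^2\equiv0$, $\rho_1=\rho_2=1$, $C_1=C_2=0$, $G=0$, $D_2=0$, $F_1=F_2=0$, $D_3=0$, and for all $K\ge0$ $$\mathbf E[f(\bar x^K)-f(x^* )]\le\left(1-\frac{\gamma\mu}2\right)^K\frac{4\|x^0-x^*\|^2}\gamma$$ when $\mu>0$, and $$\mathbf E[f(\bar x^K)-f(x^* )]\le\frac{4\|x^0-x^*\|^2}{K\gamma}$$ when $\mu=0$ (right-hand side read as $+\infty$ for $K=0$).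
   Context: $f(x)=\frac1n\sum_{i=1}^nf_i(x)$ on $\mathbb R^d$. A function is $L$-smooth if it is differentiable with $L$-Lipschitz gradient. $f$ is $\mu$-quasi strongly convex if it has a unique minimizer $x^*$ and $f(x^* )\ge f(x)+\langle\nabla f(x),x^*-x\rangle+\frac\mu2\|x-x^*\|^2$ for all $x$. $\mathcal C$ is a (possibly randomized) compression operator with $\mathbf E\|\mathcal C(x)-x\|^2\le(1-\delta)\|x\|^2$ for all $x$, $\delta\in(0,1]$; every application uses fresh independent randomness. EC-GDstar: given deterministic $x^0\in\mathbb R^d$, $e_i^0=0$; at iteration $k\ge0$ each worker $i$ sets $g_i^k=\nabla f_i(x^k)-\nabla f_i(x^* )$, $v_i^k=\mathcal C(e_i^k+\gamma g_i^k)$, $e_i^{k+1}=e_i^k+\gamma g_i^k-v_i^k$; then $x^{k+1}=x^k-\frac1n\sum_iv_i^k$. Parametric assumption: let $g^k=\frac1n\sum_ig_i^k$, $e^k=\frac1n\sum_ie_i^k$, $\mathbf E_k$ the conditional expectation given all randomness generated before iteration $k$, $\bar g_i^k=\mathbf E_k[g_i^k]$. For all $k,K\ge0$: $\mathbf E_k[g^k]=\nabla f(x^k)$; $\frac1n\sum_i\|\bar g_i^k\|^2\le2A(f(x^k)-f(x^* ))+B_1\sigma_{1,k}^2+B_2\sigma_{2,k}^2+D_1$; $\frac1n\sum_i\mathbf E_k\|g_i^k-\bar g_i^k\|^2\le2\widetilde A(f(x^k)-f(x^* ))+\widetilde B_1\sigma_{1,k}^2+\widetilde B_2\sigma_{2,k}^2+\widetilde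 D_1$; $\mathbf E_k\|g^k\|^2\le2A'(f(x^k)-f(x^* ))+B_1'\sigma_{1,k}^2+B_2'\sigma_{2,k}^2+D_1'$; $\mathbf E_k[\sigma_{1,k+1}^2]\le(1-\rho_1)\sigma_{1,k}^2+2C_1(f(x^k)-f(x^* ))+G\rho_1\sigma_{2,k}^2+D_2$; $\mathbf E_k[\sigma_{2,k+1}^2]\le(1-\rho_2)\sigma_{2,k}^2+2C_2(f(x^k)-f(x^* ))$; $3L\sum_{k=0}^Kw_k\mathbf E\|e^k\|^2\le\frac14\sum_{k=0}^Kw_k\mathbf E[f(x^k)-f(x^* )]+F_1\sigma_{1,0}^2+F_2\sigma_{2,0}^2+\gamma D_3W_K$, where $w_k=(1-\eta)^{-(k+1)}$, $W_K=\sum_{k=0}^Kw_k$, $\eta=\min\{\frac{\gamma\mu}2,\frac{\rho_1}4,\frac{\rho_2}4\}$. Also $\bar x^K=\frac1{W_K}\sum_{k=0}^Kw_kx^k$. *)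

theory Defs
  imports "HOL-Probability.Probability"
begin

definition grad :: "('a::euclidean_space \<Rightarrow> real) \<Rightarrow> 'a \<Rightarrow> 'a" where
  "grad f x = (THE D. GDERIV f x :> D)"

definition L_smooth :: "real \<Rightarrow> ('a::euclidean_space \<Rightarrow> real) \<Rightarrow> bool" where
  "L_smooth L f \<longleftrightarrow> (\<forall>x. f differentiable (at x)) \<and> L-lipschitz_on UNIV (grad f)"

text \<open>\<open>xs\<close> is the minimizer written \<open>x\<^sup>*\<close> on paper.\<close>

definition quasi_strongly_convex :: "real \<Rightarrow> ('a::euclidean_space \<Rightarrow> real) \<Rightarrow> 'a \<Rightarrow> bool" where
  "quasi_strongly_convex \<mu> f xs \<longleftrightarrow>
     is_arg_min f (\<lambda>_. True) xs \<and> (\<forall>y. is_arg_min f (\<lambda>_. True) y \<longrightarrow> y = xs) \<and>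
     (\<forall>x. f xs \<ge> f x + grad f x \<bullet> (xs - x) + \<mu> / 2 * (norm (x - xs))\<^sup>2)"

text \<open>Workers are indexed by \<open>{1..n}\<close>.\<close>

definition avg :: "nat \<Rightarrow> (nat \<Rightarrow> 'b::real_vector) \<Rightarrow> 'b" where
  "avg n u = (1 / real n) *\<^sub>R (\<Sum>i=1..n. u i)"

text \<open>A randomized operator is a map \<open>C s x\<close> taking a random seed \<open>s\<close>, drawn from the
  probability space \<open>S\<close>, in addition to its argument \<open>x\<close>.\<close>

definition compressor ::
    "real \<Rightarrow> 's measure \<Rightarrow> ('s \<Rightarrow> 'a::euclidean_space \<Rightarrow> 'a) \<Rightarrow> bool" where
  "compressor \<delta> S C \<longleftrightarrow>
     0 < \<delta> \<and> \<delta> \<le> 1 \<and> prob_space S \<and>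
     (\<lambda>(s, x). C s x) \<in> borel_measurable (S \<Otimes>\<^sub>M borel) \<and>
     (\<forall>x. integrable S (\<lambda>s. (norm (C s x - x))\<^sup>2) \<and>
          (LINT s|S. (norm (C s x - x))\<^sup>2) \<le> (1 - \<delta>) * (norm x)\<^sup>2)"

text \<open>\<open>\<xi> i k\<close> is the seed used by worker \<open>i\<close> at iteration \<open>k\<close>.\<close>

definition fresh_seeds ::
    "'w measure \<Rightarrow> 's measure \<Rightarrow> nat \<Rightarrow> (nat \<Rightarrow> nat \<Rightarrow> 'w \<Rightarrow> 's) \<Rightarrow> bool" where
  "fresh_seeds M S n \<xi> \<longleftrightarrow>
     prob_space.indep_vars M (\<lambda>_. S) (\<lambda>(i, k). \<xi> i k) ({1..n} \<times> UNIV) \<and>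
     (\<forall>i\<in>{1..n}. \<forall>k. distr M S (\<xi> i k) = S)"

text \<open>The sigma-algebra of all randomness generated before iteration \<open>k\<close>.\<close>

definition past ::
    "'w measure \<Rightarrow> 's measure \<Rightarrow> nat \<Rightarrow> (nat \<Rightarrow> nat \<Rightarrow> 'w \<Rightarrow> 's) \<Rightarrow> nat \<Rightarrow> 'w measure" where
  "past M S n \<xi> k =
     sigma (space M) {\<xi> i j -` A \<inter> space M | i j A. i \<in> {1..n} \<and> j < k \<and> A \<in> sets S}"

definition EC_GDstar ::
    "'w measure \<Rightarrow> nat \<Rightarrow> (nat \<Rightarrow> 'a::euclidean_space \<Rightarrow> real) \<Rightarrow> 'a \<Rightarrow> 'a \<Rightarrow> real \<Rightarrow>
     ('s \<Rightarrow> 'a \<Rightarrow> 'a) \<Rightarrow> (nat \<Rightarrow> nat \<Rightarrow> 'w \<Rightarrow> 's) \<Rightarrow>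
     (nat \<Rightarrow> 'w \<Rightarrow> 'a) \<Rightarrow> (nat \<Rightarrow> nat \<Rightarrow> 'w \<Rightarrow> 'a) \<Rightarrow> (nat \<Rightarrow> nat \<Rightarrow> 'w \<Rightarrow> 'a) \<Rightarrow>
     (nat \<Rightarrow> nat \<Rightarrow> 'w \<Rightarrow> 'a) \<Rightarrow> bool" where
  "EC_GDstar M n f xs x0 \<gamma> C \<xi> x e g v \<longleftrightarrow>
     (\<forall>\<omega>\<in>space M.
        x 0 \<omega> = x0 \<and>
        (\<forall>i\<in>{1..n}. e i 0 \<omega> = 0) \<and>
        (\<forall>k. \<forall>i\<in>{1..n}.
           g i k \<omega> = grad (f i) (x k \<omega>) - grad (f i) xs \<and>
           v i k \<omega> = C (\<xi> i k \<omega>) (e i k \<omega> + \<gamma> *\<^sub>R g i k \<omega>) \<and>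
           e i (Suc k) \<omega> = e i k \<omega> + \<gamma> *\<^sub>R g i k \<omega> - v i k \<omega>) \<and>
        (\<forall>k. x (Suc k) \<omega> = x k \<omega> - avg n (\<lambda>i. v i k \<omega>)))"

text \<open>Conditional expectation of a vector-valued random variable, taken coordinatewise.\<close>

definition vec_cond_exp ::
    "'w measure \<Rightarrow> 'w measure \<Rightarrow> ('w \<Rightarrow> 'a::euclidean_space) \<Rightarrow> 'w \<Rightarrow> 'a" where
  "vec_cond_exp M F X \<omega> = (\<Sum>b\<in>Basis. real_cond_exp M F (\<lambda>\<omega>'. X \<omega>' \<bullet> b) \<omega> *\<^sub>R b)"

text \<open>Suffix \<open>_t\<close> stands for a tilde, suffix \<open>_p\<close> for a prime.\<close>

record ec_constants =
  cA :: real
  cA_t :: real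
  cA_p :: real
  cB1 :: real
  cB2 :: real
  cB1_t :: real
  cB2_t :: real
  cB1_p :: real
  cB2_p :: real
  cC1 :: real
  cC2 :: real
  cD1 :: real
  cD1_t :: real
  cD1_p :: real
  cD2 :: real
  cD3 :: real
  cF1 :: real
  cF2 :: real
  cG :: real
  crho1 :: real
  crho2 :: real

definition ec_eta :: "real \<Rightarrow> real \<Rightarrow> real \<Rightarrow> real \<Rightarrow> real" where
  "ec_eta \<gamma> \<mu> \<rho>1 \<rho>2 = min (\<gamma> * \<mu> / 2) (min (\<rho>1 / 4) (\<rho>2 / 4))"

definition ec_weight :: "real \<Rightarrow> nat \<Rightarrow> real" where
  "ec_weight \<eta> k = 1 / (1 - \<eta>) ^ (k + 1)"

definition ec_weight_sum :: "real \<Rightarrow> nat \<Rightarrow> real" where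
  "ec_weight_sum \<eta> K = (\<Sum>k=0..K. ec_weight \<eta> k)"

definition weighted_iterate ::
    "real \<Rightarrow> (nat \<Rightarrow> 'w \<Rightarrow> 'a::euclidean_space) \<Rightarrow> nat \<Rightarrow> 'w \<Rightarrow> 'a" where
  "weighted_iterate \<eta> x K \<omega> =
     (1 / ec_weight_sum \<eta> K) *\<^sub>R (\<Sum>k=0..K. ec_weight \<eta> k *\<^sub>R x k \<omega>)"

text \<open>\<open>s1 k\<close> and \<open>s2 k\<close> denote the squared quantities \<open>\<sigma>\<^sub>1\<^sub>,\<^sub>k\<^sup>2\<close> and \<open>\<sigma>\<^sub>2\<^sub>,\<^sub>k\<^sup>2\<close>. Relations between conditional
  expectations hold almost surely. Every (conditional) expectation is accompanied by the
  integrability that makes it meaningful, since the library assigns a default value to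
  expectations that do not exist.\<close>

definition parametric_assumption ::
    "'w measure \<Rightarrow> (nat \<Rightarrow> 'w measure) \<Rightarrow> nat \<Rightarrow> ('a::euclidean_space \<Rightarrow> real) \<Rightarrow> 'a \<Rightarrow>
     real \<Rightarrow> real \<Rightarrow> real \<Rightarrow>
     (nat \<Rightarrow> 'w \<Rightarrow> 'a) \<Rightarrow> (nat \<Rightarrow> nat \<Rightarrow> 'w \<Rightarrow> 'a) \<Rightarrow> (nat \<Rightarrow> nat \<Rightarrow> 'w \<Rightarrow> 'a) \<Rightarrow>
     (nat \<Rightarrow> 'w \<Rightarrow> real) \<Rightarrow> (nat \<Rightarrow> 'w \<Rightarrow> real) \<Rightarrow> ec_constants \<Rightarrow> bool" where
  "parametric_assumption M F n f xs L \<mu> \<gamma> x e g s1 s2 c \<longleftrightarrow>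
    (let gm = (\<lambda>k \<omega>. avg n (\<lambda>i. g i k \<omega>));
         em = (\<lambda>k \<omega>. avg n (\<lambda>i. e i k \<omega>));
         gbar = (\<lambda>i k. vec_cond_exp M (F k) (g i k));
         gap = (\<lambda>k \<omega>. f (x k \<omega>) - f xs);
         w = ec_weight (ec_eta \<gamma> \<mu> (crho1 c) (crho2 c));
         W = ec_weight_sum (ec_eta \<gamma> \<mu> (crho1 c) (crho2 c))
     in
      (\<forall>k.
        integrable M (gm k) \<and>
        (AE \<omega> in M. vec_cond_exp M (F k) (gm k) \<omega> = grad f (x k \<omega>)) \<and>

        (\<forall>i\<in>{1..n}. integrable M (g i k)) \<and>
        (AE \<omega> in M. avg n (\<lambda>i. (norm (gbar i k \<omega>))\<^sup>2)
           \<le> 2 * cA c * gap k \<omega> + cB1 c * s1 k \<omega> + cB2 c * s2 k \<omega> + cD1 c) \<and>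

        (\<forall>i\<in>{1..n}. integrable M (\<lambda>\<omega>. (norm (g i k \<omega> - gbar i k \<omega>))\<^sup>2)) \<and>
        (AE \<omega> in M.
           avg n (\<lambda>i. real_cond_exp M (F k) (\<lambda>\<omega>'. (norm (g i k \<omega>' - gbar i k \<omega>'))\<^sup>2) \<omega>)
           \<le> 2 * cA_t c * gap k \<omega> + cB1_t c * s1 k \<omega> + cB2_t c * s2 k \<omega> + cD1_t c) \<and>

        integrable M (\<lambda>\<omega>. (norm (gm k \<omega>))\<^sup>2) \<and>
        (AE \<omega> in M. real_cond_exp M (F k) (\<lambda>\<omega>'. (norm (gm k \<omega>'))\<^sup>2) \<omega>
           \<le> 2 * cA_p c * gap k \<omega> + cB1_p c * s1 k \<omega> + cB2_p c * s2 k \<omega> + cD1_p c) \<and>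

        integrable M (s1 (Suc k)) \<and>
        (AE \<omega> in M. real_cond_exp M (F k) (s1 (Suc k)) \<omega>
           \<le> (1 - crho1 c) * s1 k \<omega> + 2 * cC1 c * gap k \<omega>
             + cG c * crho1 c * s2 k \<omega> + cD2 c) \<and>

        integrable M (s2 (Suc k)) \<and>
        (AE \<omega> in M. real_cond_exp M (F k) (s2 (Suc k)) \<omega>
           \<le> (1 - crho2 c) * s2 k \<omega> + 2 * cC2 c * gap k \<omega>) \<and>

        integrable M (\<lambda>\<omega>. (norm (em k \<omega>))\<^sup>2) \<and>
        integrable M (gap k)) \<and>
      (\<forall>K. AE \<omega> in M.
        3 * L * (\<Sum>k=0..K. w k * (LINT \<omega>'|M. (norm (em k \<omega>'))\<^sup>2))
          \<le> 1 / 4 * (\<Sum>k=0..K. w k * (LINT \<omega>'|M. gap k \<omega>'))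
            + cF1 c * s1 0 \<omega> + cF2 c * s2 0 \<omega> + \<gamma> * cD3 c * W K))"

end

theory Submission
  imports Defs
begin

text \<open>
  Error compensation hides an exact gradient method. Let \<open>e\<close> and \<open>g\<close> be the averages of the workers'
  errors and of their shifted gradients; since the minimizer \<open>xs\<close> is a critical point of the averaged
  objective \<open>fm\<close>, \<open>g\<close> is the full gradient of \<open>fm\<close> at \<open>x\<close>. What compression withholds from a step is
  stored in \<open>e\<close>, so the virtual iterate \<open>x - e\<close> moves by exactly \<open>-\<gamma> g\<close> (\<open>virtual_step\<close>). Quasi strong
  convexity and \<open>\<parallel>g\<parallel>\<^sup>2 \<le> 2 L (fm x - fm xs)\<close>, which follows from cocoercivity of the gradients of smooth
  convex functions, then give, for the squared distance \<open>r\<close> of the virtual iterate to \<open>xs\<close>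
  (\<open>dist_sq_step\<close>), that its next value is at most
  \<open>(1 - \<gamma> \<mu> / 2) r - (\<gamma> / 2) (fm x - fm xs) + 3 L \<gamma> \<parallel>e\<parallel>\<^sup>2\<close>.

  It remains to control the errors. Every worker compresses an argument that is determined by the
  past, with a fresh seed; by independence the contraction property of the compressor applies to this
  random argument (\<open>joint_distr_past_seed\<close>, \<open>compressor_error_contraction\<close>). Young's inequality turns
  it into the recursion \<open>err (k + 1) \<le> (1 - \<delta> / 2) err k + (4 \<gamma>\<^sup>2 L / \<delta>) E[fm x - fm xs]\<close> for the mean squared
  error of the workers. Both recursions are summed with the weights \<open>w k\<close>, which make them telescope
  (\<open>weighted_telescope\<close>). For the errors this requires \<open>\<gamma> \<mu> / 2\<close> to be small compared with \<open>\<delta>\<close>, and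
  that is where \<open>\<mu> \<le> L\<close> (\<open>quasi_strong_convexity_le_smoothness\<close>) enters together with the bound on the step
  size; the same two facts identify the rate \<open>\<eta>\<close> as \<open>\<gamma> \<mu> / 2\<close>. The step size is such that the weighted
  errors consume at most half of the weighted gaps (\<open>weighted_err_le\<close>), whence the weighted sum of the
  expected gaps is at most \<open>4 \<parallel>x0 - xs\<parallel>\<^sup>2 / \<gamma>\<close> (\<open>weighted_gap_le\<close>). Jensen's inequality passes to the averaged
  iterate, and the two rates come from lower bounds on the sum of the weights.

  The other parts of the parametric assumption are immediate: the gradients at iteration \<open>k\<close> are
  measurable with respect to the past, so conditional expectations leave them unchanged, and their
  conditional variance is zero. Square integrability of the iterates and of the errors, obtained by
  induction on the iteration, makes all expectations meaningful.
\<close>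

section \<open>Gradients of smooth convex functions\<close>

lemma grad_eqI:
  assumes "GDERIV f x :> D"
  shows "grad f x = D"
  unfolding grad_def
proof (rule the_equality)
  show "GDERIV f x :> D" by fact
next
  fix D' assume "GDERIV f x :> D'"
  then have "(\<lambda>h. h \<bullet> D') = (\<lambda>h. h \<bullet> D)"
    using assms unfolding gderiv_def by (rule has_derivative_unique)
  then have "h \<bullet> D' = h \<bullet> D" for h by meson
  then show "D' = D" using vector_eq_ldot by blast
qed

lemma GDERIV_grad:
  assumes "f differentiable (at x)"
  shows "GDERIV f x :> grad f x"
proof -
  obtain f' where f': "(f has_derivative f') (at x)"
    using assms by (auto simp: differentiable_def)
  then interpret bounded_linear f' by (rule has_derivative_bounded_linear)
  have "f' = (\<lambda>h. h \<bullet> (\<Sum>b\<in>Basis. f' b *\<^sub>R b))"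
  proof
    fix h
    have "f' h = f' (\<Sum>b\<in>Basis. (h \<bullet> b) *\<^sub>R b)" by (simp add: euclidean_representation)
    also have "\<dots> = (\<Sum>b\<in>Basis. (h \<bullet> b) * f' b)" by (simp add: sum scaleR)
    also have "\<dots> = h \<bullet> (\<Sum>b\<in>Basis. f' b *\<^sub>R b)" by (simp add: inner_sum_right mult.commute)
    finally show "f' h = h \<bullet> (\<Sum>b\<in>Basis. f' b *\<^sub>R b)" .
  qed
  then have "GDERIV f x :> (\<Sum>b\<in>Basis. f' b *\<^sub>R b)"
    using f' by (simp add: gderiv_def)
  then show ?thesis using grad_eqI by metis
qed

lemma DERIV_along_line:
  assumes "f differentiable (at (x + t *\<^sub>R d))"
  shows "((\<lambda>s. f (x + s *\<^sub>R d)) has_real_derivative (grad f (x + t *\<^sub>R d) \<bullet> d)) (at t)"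
proof -
  have f: "(f has_derivative (\<lambda>h. h \<bullet> grad f (x + t *\<^sub>R d))) (at (x + t *\<^sub>R d))"
    using GDERIV_grad[OF assms] by (simp add: gderiv_def)
  have line: "((\<lambda>s. x + s *\<^sub>R d) has_derivative (\<lambda>s. s *\<^sub>R d)) (at t)"
    by (auto intro!: derivative_eq_intros)
  have "((\<lambda>s. f (x + s *\<^sub>R d)) has_derivative (\<lambda>s. (s *\<^sub>R d) \<bullet> grad f (x + t *\<^sub>R d))) (at t)"
    by (rule has_derivative_compose[OF line f])
  moreover have "(\<lambda>s. (s *\<^sub>R d) \<bullet> grad f (x + t *\<^sub>R d)) = (*) (grad f (x + t *\<^sub>R d) \<bullet> d)"
    by (simp add: fun_eq_iff inner_commute mult.commute)
  ultimately show ?thesis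
    by (simp only: has_field_derivative_def)
qed

text \<open>Restricting to the line through \<open>x\<close> and \<open>y\<close> reduces this to the one-dimensional tangent
  inequality.\<close>

lemma convex_above_tangent:
  assumes "convex_on UNIV f" and "f differentiable (at x)"
  shows "f x + grad f x \<bullet> (y - x) \<le> f y"
proof -
  let ?h = "\<lambda>s. f (x + s *\<^sub>R (y - x))"
  have conv: "convex_on UNIV ?h"
  proof (rule convex_onI)
    fix t s u :: real assume "0 < t" "t < 1"
    have "x + ((1 - t) *\<^sub>R s + t *\<^sub>R u) *\<^sub>R (y - x)
        = (1 - t) *\<^sub>R (x + s *\<^sub>R (y - x)) + t *\<^sub>R (x + u *\<^sub>R (y - x))"
      by (simp add: algebra_simps)
    then show "f (x + ((1 - t) *\<^sub>R s + t *\<^sub>R u) *\<^sub>R (y - x))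
        \<le> (1 - t) * f (x + s *\<^sub>R (y - x)) + t * f (x + u *\<^sub>R (y - x))"
      using convex_onD[OF assms(1), of t] \<open>0 < t\<close> \<open>t < 1\<close> by simp
  qed simp
  have deriv: "(?h has_real_derivative (grad f x \<bullet> (y - x))) (at 0)"
    using DERIV_along_line[of f x 0 "y - x"] assms(2) by (simp only: scaleR_zero_left add_0_right)
  have "grad f x \<bullet> (y - x) * (1 - 0) \<le> ?h 1 - ?h 0"
    by (rule convex_on_imp_above_tangent[OF conv _ _ _ deriv]) simp_all
  then show ?thesis by simp
qed

lemma L_smoothD:
  assumes "L_smooth L f"
  shows "f differentiable (at x)" "norm (grad f x - grad f y) \<le> L * norm (x - y)"
  using assms by (auto simp: L_smooth_def lipschitz_on_def dist_norm)

text \<open>The descent lemma. Along the segment from \<open>x\<close> to \<open>y\<close> the difference between \<open>f\<close> and its quadratic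
  majorant has derivative at most \<open>0\<close>, because the gradient is \<open>L\<close>-Lipschitz.\<close>

lemma L_smooth_descent:
  assumes "L_smooth L f"
  shows "f y \<le> f x + grad f x \<bullet> (y - x) + L / 2 * (norm (y - x))\<^sup>2"
proof -
  define d where "d = y - x"
  let ?\<phi> = "\<lambda>s. f (x + s *\<^sub>R d) - s * (grad f x \<bullet> d) - L / 2 * s\<^sup>2 * (norm d)\<^sup>2"
  have "?\<phi> 1 \<le> ?\<phi> 0"
  proof (rule DERIV_nonpos_imp_nonincreasing[where f = ?\<phi>])
    fix t :: real assume t: "0 \<le> t" "t \<le> 1"
    let ?D = "grad f (x + t *\<^sub>R d) \<bullet> d - grad f x \<bullet> d - L * t * (norm d)\<^sup>2"
    have "(?\<phi> has_real_derivative ?D) (at t)"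
      by (auto intro!: derivative_eq_intros DERIV_along_line L_smoothD(1)[OF assms])
    moreover have "?D \<le> 0"
    proof -
      have "grad f (x + t *\<^sub>R d) \<bullet> d - grad f x \<bullet> d \<le> norm (grad f (x + t *\<^sub>R d) - grad f x) * norm d"
        using norm_cauchy_schwarz[of "grad f (x + t *\<^sub>R d) - grad f x" d] by (simp add: inner_diff_left)
      also have "\<dots> \<le> (L * (t * norm d)) * norm d"
        using L_smoothD(2)[OF assms, of "x + t *\<^sub>R d" x] t by (intro mult_right_mono) auto
      finally show ?thesis by (simp add: power2_eq_square mult_ac)
    qed
    ultimately show "\<exists>D. (?\<phi> has_real_derivative D) (at t) \<and> D \<le> 0" by blast
  qed simp
  moreover have "x + d = y" by (simp add: d_def)
  ultimately show ?thesis by (simp flip: d_def)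
qed

text \<open>At \<open>z = x - (1 / L) (\<nabla>f(x) - \<nabla>f(y))\<close>, the minimizer of the quadratic upper bound minus the tangent
  at \<open>y\<close>, the value of \<open>f\<close> is squeezed between the tangent at \<open>y\<close> and the descent bound from \<open>x\<close>;
  comparing the two bounds leaves the squared gradient difference.\<close>

lemma convex_L_smooth_cocoercive:
  assumes "convex_on UNIV f" "L_smooth L f" "L > 0"
  shows "(norm (grad f x - grad f y))\<^sup>2 \<le> 2 * L * (f x - f y - grad f y \<bullet> (x - y))"
proof -
  define u where "u = grad f x - grad f y"
  define z where "z = x - (1 / L) *\<^sub>R u"
  have low: "f y + grad f y \<bullet> (z - y) \<le> f z"
    by (rule convex_above_tangent) (auto intro: assms L_smoothD(1))
  have up: "f z \<le> f x + grad f x \<bullet> (z - x) + L / 2 * (norm (z - x))\<^sup>2"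
    by (rule L_smooth_descent) fact
  have zx: "z - x = - (1 / L) *\<^sub>R u" by (simp add: z_def)
  have "(norm (z - x))\<^sup>2 = (norm u)\<^sup>2 / L\<^sup>2"
    unfolding zx by (simp add: power_divide)
  then have sq: "L / 2 * (norm (z - x))\<^sup>2 = (norm u)\<^sup>2 / (2 * L)"
    using \<open>L > 0\<close> by (simp add: power2_eq_square)
  have "u \<bullet> (z - x) = - ((norm u)\<^sup>2 / L)"
    unfolding zx by (simp add: dot_square_norm)
  then have "grad f x \<bullet> (z - x) - grad f y \<bullet> (z - x) = - ((norm u)\<^sup>2 / L)"
    by (simp add: u_def inner_diff_left)
  moreover have "grad f y \<bullet> (z - y) = grad f y \<bullet> (z - x) + grad f y \<bullet> (x - y)"
    by (simp add: inner_diff_right)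
  ultimately have "f y + grad f y \<bullet> (x - y) \<le> f x - (norm u)\<^sup>2 / L + (norm u)\<^sup>2 / (2 * L)"
    using low up sq by linarith
  moreover have "(norm u)\<^sup>2 / L = 2 * ((norm u)\<^sup>2 / (2 * L))"
    by simp
  ultimately have "(norm u)\<^sup>2 / (2 * L) \<le> f x - f y - grad f y \<bullet> (x - y)"
    by linarith
  then show ?thesis
    using \<open>L > 0\<close> by (simp add: u_def[symmetric] pos_divide_le_eq mult.commute)
qed

lemma grad_minimizer:
  assumes "f differentiable (at x)" "is_arg_min f (\<lambda>_. True) x"
  shows "grad f x = 0"
proof (rule grad_eqI)
  obtain f' where f': "(f has_derivative f') (at x)"
    using assms(1) by (auto simp: differentiable_def)
  moreover have "\<forall>y\<in>UNIV. f x \<le> f y"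
    using assms(2) by (auto simp: is_arg_min_def not_less)
  ultimately have "f' = (\<lambda>h. 0)"
    using differential_zero_maxmin[of x UNIV f f'] by auto
  then show "GDERIV f x :> 0"
    using f' by (simp add: gderiv_def)
qed

section \<open>Averages\<close>

lemma avg_add: "avg n (\<lambda>i. u i + v i) = avg n u + avg n v"
  and avg_diff: "avg n (\<lambda>i. u i - v i) = avg n u - avg n v"
  and avg_scaleR: "avg n (\<lambda>i. c *\<^sub>R u i) = c *\<^sub>R avg n u"
  by (simp_all add: avg_def sum.distrib sum_subtractf algebra_simps scaleR_sum_right)

lemma avg_mult: "avg n (\<lambda>i. c * u i) = c * avg n u" for c :: real
  using avg_scaleR[of n c u] by simp

lemma avg_cong: "(\<And>i. i \<in> {1..n} \<Longrightarrow> u i = v i) \<Longrightarrow> avg n u = avg n v"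
  by (simp add: avg_def)

lemma avg_mono: "(\<And>i. i \<in> {1..n} \<Longrightarrow> u i \<le> v i) \<Longrightarrow> avg n u \<le> avg n v" for u v :: "nat \<Rightarrow> real"
  by (auto simp: avg_def intro!: mult_left_mono sum_mono divide_right_mono)

lemma norm_avg_le: "(norm (avg n u))\<^sup>2 \<le> avg n (\<lambda>i. (norm (u i))\<^sup>2)"
proof -
  have "(norm (\<Sum>i=1..n. u i))\<^sup>2 \<le> (\<Sum>i=1..n. norm (u i))\<^sup>2"
    by (intro power_mono norm_sum) simp
  also have "\<dots> \<le> (\<Sum>i=1..n. (norm (u i))\<^sup>2) * real n"
    using sum_squared_le_sum_of_squares[of "\<lambda>i. norm (u i)" "{1..n}"] by simp
  finally have "(norm (\<Sum>i=1..n. u i))\<^sup>2 \<le> (\<Sum>i=1..n. (norm (u i))\<^sup>2) * real n" .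
  then show ?thesis
    by (cases "n = 0") (auto simp: avg_def power_mult_distrib power2_eq_square field_simps)
qed

lemma avg_inner: "avg n u \<bullet> y = avg n (\<lambda>i. u i \<bullet> y)"
  by (simp add: avg_def inner_sum_left)

lemma GDERIV_avg:
  assumes "\<And>i. i \<in> {1..n} \<Longrightarrow> GDERIV (f i) x :> D i"
  shows "GDERIV (\<lambda>y. avg n (\<lambda>i. f i y)) x :> avg n D"
proof -
  have "((\<lambda>y. (1 / real n) *\<^sub>R (\<Sum>i=1..n. f i y)) has_derivative
      (\<lambda>h. (1 / real n) *\<^sub>R (\<Sum>i=1..n. h \<bullet> D i))) (at x)"
    using assms by (intro derivative_intros) (auto simp: gderiv_def)
  then show ?thesis
    by (simp add: gderiv_def avg_def inner_sum_right)
qed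

lemma grad_avg:
  assumes "\<And>i. i \<in> {1..n} \<Longrightarrow> L_smooth L (f i)"
  shows "grad (\<lambda>y. avg n (\<lambda>i. f i y)) x = avg n (\<lambda>i. grad (f i) x)"
  by (intro grad_eqI GDERIV_avg GDERIV_grad) (rule L_smoothD(1)[OF assms])

lemma L_smooth_avg:
  assumes "\<And>i. i \<in> {1..n} \<Longrightarrow> L_smooth L (f i)" and "L \<ge> 0"
  shows "L_smooth L (\<lambda>y. avg n (\<lambda>i. f i y))"
  unfolding L_smooth_def
proof (intro conjI allI)
  fix x show "(\<lambda>y. avg n (\<lambda>i. f i y)) differentiable (at x)"
    using GDERIV_avg[of n f x "\<lambda>i. grad (f i) x"] GDERIV_grad L_smoothD(1)[OF assms(1)]
    unfolding gderiv_def differentiable_def by blast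
next
  have grad: "grad (\<lambda>y. avg n (\<lambda>i. f i y)) x = avg n (\<lambda>i. grad (f i) x)" for x
    by (rule grad_avg) (rule assms(1))
  show "L-lipschitz_on UNIV (grad (\<lambda>y. avg n (\<lambda>i. f i y)))"
  proof (rule lipschitz_onI)
    fix x y :: 'a
    have "norm (avg n (\<lambda>i. grad (f i) x - grad (f i) y)) \<le> avg n (\<lambda>i. L * norm (x - y))"
    proof -
      have "norm (\<Sum>i=1..n. grad (f i) x - grad (f i) y) \<le> (\<Sum>i=1..n. L * norm (x - y))"
        by (intro sum_norm_le L_smoothD(2) assms)
      from divide_right_mono[OF this, of "real n"] show ?thesis by (simp add: avg_def)
    qed
    also have "\<dots> \<le> L * norm (x - y)"
      using \<open>L \<ge> 0\<close> by (cases "n = 0") (simp_all add: avg_def)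
    finally show "dist (grad (\<lambda>y. avg n (\<lambda>i. f i y)) x) (grad (\<lambda>y. avg n (\<lambda>i. f i y)) y) \<le> L * dist x y"
      by (simp add: grad avg_diff dist_norm)
  qed (fact assms(2))
qed

lemma convex_on_avg:
  assumes "\<And>i. i \<in> {1..n} \<Longrightarrow> convex_on UNIV (f i)"
  shows "convex_on UNIV (\<lambda>y. avg n (\<lambda>i. f i y))"
proof (rule convex_onI)
  fix t :: real and x y :: 'a assume t: "0 < t" "t < 1"
  have "avg n (\<lambda>i. f i ((1 - t) *\<^sub>R x + t *\<^sub>R y)) \<le> avg n (\<lambda>i. (1 - t) * f i x + t * f i y)"
    using t by (intro avg_mono convex_onD[OF assms]) auto
  then show "avg n (\<lambda>i. f i ((1 - t) *\<^sub>R x + t *\<^sub>R y))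
      \<le> (1 - t) * avg n (\<lambda>i. f i x) + t * avg n (\<lambda>i. f i y)"
    by (simp add: avg_add avg_mult)
qed simp

text \<open>Quasi strong convexity bounds the inner product of the gradient with \<open>y - xs\<close> from below by
  the gap plus \<open>\<mu> / 2\<close>, for any \<open>y\<close> at distance \<open>1\<close> from \<open>xs\<close>. Cocoercivity bounds the gap from
  below by \<open>1 / (2 L)\<close> times the squared gradient, and Young's inequality then forces \<open>\<mu> \<le> L\<close>.
  The comparison makes the rate \<open>\<gamma> \<mu> / 2\<close> small against \<open>\<delta>\<close>.\<close>

lemma quasi_strong_convexity_le_smoothness:
  fixes f :: "'a::euclidean_space \<Rightarrow> real"
  assumes "convex_on UNIV f" "L_smooth L f" "L > 0" "quasi_strongly_convex \<mu> f xs"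
  shows "\<mu> \<le> L"
proof -
  \<comment> \<open>A Euclidean space has positive dimension, so a test point at distance 1 from the minimizer exists.\<close>
  obtain b :: 'a where b: "b \<in> Basis" using nonempty_Basis by blast
  define y where "y = xs + b"
  define G where "G = grad f y"
  have n1: "norm (xs - y) = 1" "norm (y - xs) = 1" using b by (simp_all add: y_def)
  have qsc: "f y + G \<bullet> (xs - y) + \<mu> / 2 \<le> f xs"
    using assms(4) n1 unfolding quasi_strongly_convex_def G_def by (metis mult.right_neutral one_power2)
  have "grad f xs = 0"
    using assms by (intro grad_minimizer L_smoothD(1)) (auto simp: quasi_strongly_convex_def)
  then have "(norm G)\<^sup>2 \<le> 2 * L * (f y - f xs)"
    using convex_L_smooth_cocoercive[OF assms(1-3), of y xs] by (simp add: G_def)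
  moreover have "- (2 * L * (G \<bullet> (xs - y))) \<le> (norm G)\<^sup>2 + L\<^sup>2"
  proof -
    have "0 \<le> (norm (G + L *\<^sub>R (xs - y)))\<^sup>2" by simp
    also have "\<dots> = (norm G)\<^sup>2 + 2 * L * (G \<bullet> (xs - y)) + L\<^sup>2 * (norm (xs - y))\<^sup>2"
      by (simp add: power2_norm_eq_inner inner_add_left inner_add_right inner_commute)
        (simp add: power2_eq_square)
    finally show ?thesis using n1 by simp
  qed
  moreover have "L * \<mu> \<le> 2 * L * (f xs - f y) - 2 * L * (G \<bullet> (xs - y))"
    using mult_left_mono[OF qsc, of "2 * L"] \<open>L > 0\<close> by (simp add: algebra_simps)
  ultimately have "L * \<mu> \<le> L * L" by (simp add: power2_eq_square algebra_simps)
  then show ?thesis using \<open>L > 0\<close> by simp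
qed

section \<open>Young inequalities and weighted recursions\<close>

lemma two_inner_le_Young:
  fixes a b :: "'a::real_inner"
  assumes "t > 0"
  shows "2 * (a \<bullet> b) \<le> t * (norm a)\<^sup>2 + (norm b)\<^sup>2 / t"
proof -
  have "0 \<le> (norm (t *\<^sub>R a - b))\<^sup>2" by simp
  also have "\<dots> = t\<^sup>2 * (norm a)\<^sup>2 - 2 * t * (a \<bullet> b) + (norm b)\<^sup>2"
    by (simp only: power2_norm_eq_inner) (simp add: inner_diff_left inner_diff_right inner_commute power2_eq_square)
  finally have "t * (2 * (a \<bullet> b)) \<le> t * (t * (norm a)\<^sup>2 + (norm b)\<^sup>2 / t)"
    using assms by (simp add: power2_eq_square algebra_simps)
  then show ?thesis using assms by simp
qed

lemma norm_add_sq_le_Young: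
  fixes a b :: "'a::real_inner"
  assumes "t > 0"
  shows "(norm (a + b))\<^sup>2 \<le> (1 + t) * (norm a)\<^sup>2 + (1 + 1 / t) * (norm b)\<^sup>2"
proof -
  have "(norm (a + b))\<^sup>2 = (norm a)\<^sup>2 + 2 * (a \<bullet> b) + (norm b)\<^sup>2"
    by (simp add: power2_norm_eq_inner inner_add_left inner_add_right inner_commute)
  then show ?thesis using two_inner_le_Young[OF assms, of a b] by (simp add: algebra_simps)
qed

text \<open>Since \<open>ec_weight \<eta> (k + 1) * (1 - \<eta>) = ec_weight \<eta> k\<close>, multiplying the recursion by its weight makes
  the \<open>r\<close>-terms telescope. Both the compression error and the distance of the virtual iterate
  to the minimizer are summed with this lemma; \<open>b\<close> may be negative.\<close>

lemma weighted_telescope: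
  assumes "\<eta> < 1" and "\<And>k. r k \<ge> 0" and step: "\<And>k. r (Suc k) \<le> (1 - \<eta>) * r k - b k"
  shows "(\<Sum>k=0..K. ec_weight \<eta> k * b k) \<le> r 0"
proof -
  have w: "ec_weight \<eta> k > 0" "ec_weight \<eta> (Suc k) * (1 - \<eta>) = ec_weight \<eta> k" for k
    using assms(1) by (simp_all add: ec_weight_def)
  have w0: "ec_weight \<eta> 0 * (1 - \<eta>) = 1"
    using assms(1) by (simp add: ec_weight_def)
  have "(\<Sum>k=0..K. ec_weight \<eta> k * b k) + ec_weight \<eta> K * r (Suc K) \<le> r 0"
  proof (induction K)
    case 0
    have "ec_weight \<eta> 0 * r (Suc 0) \<le> ec_weight \<eta> 0 * ((1 - \<eta>) * r 0 - b 0)"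
      using w(1)[of 0] by (intro mult_left_mono step) simp
    also have "\<dots> = (ec_weight \<eta> 0 * (1 - \<eta>)) * r 0 - ec_weight \<eta> 0 * b 0"
      by (simp add: algebra_simps)
    finally show ?case unfolding w0 by simp
  next
    case (Suc K)
    have "ec_weight \<eta> (Suc K) * r (Suc (Suc K)) \<le> ec_weight \<eta> (Suc K) * ((1 - \<eta>) * r (Suc K) - b (Suc K))"
      using w(1)[of "Suc K"] by (intro mult_left_mono step) simp
    also have "\<dots> = (ec_weight \<eta> (Suc K) * (1 - \<eta>)) * r (Suc K) - ec_weight \<eta> (Suc K) * b (Suc K)"
      by (simp add: algebra_simps)
    finally show ?case using Suc.IH unfolding w(2) by simp
  qed
  moreover have "0 \<le> ec_weight \<eta> K * r (Suc K)"
    using w(1)[of K] assms(2) by simp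
  ultimately show ?thesis by linarith
qed

section \<open>Square-integrable random vectors\<close>

text \<open>Membership in \<open>L\<^sup>2\<close>; second moments of the errors and of the iterates are what every
  expectation in the analysis reduces to.\<close>

definition sq_integrable :: "'w measure \<Rightarrow> ('w \<Rightarrow> 'a::euclidean_space) \<Rightarrow> bool" where
  "sq_integrable M X \<longleftrightarrow> X \<in> borel_measurable M \<and> integrable M (\<lambda>\<omega>. (norm (X \<omega>))\<^sup>2)"

lemma sq_integrableD:
  assumes "sq_integrable M X"
  shows "X \<in> borel_measurable M" "integrable M (\<lambda>\<omega>. (norm (X \<omega>))\<^sup>2)"
  using assms by (auto simp: sq_integrable_def)

lemma sq_integrable_bound:
  assumes "X \<in> borel_measurable M" "integrable M h" "\<And>\<omega>. \<omega> \<in> space M \<Longrightarrow> (norm (X \<omega>))\<^sup>2 \<le> h \<omega>"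
  shows "sq_integrable M X"
  unfolding sq_integrable_def
proof
  note assms(1)[measurable]
  show "integrable M (\<lambda>\<omega>. (norm (X \<omega>))\<^sup>2)"
    using assms(3) by (intro Bochner_Integration.integrable_bound[OF assms(2)]) (auto intro!: AE_I2 order_trans[OF assms(3) abs_ge_self])
qed fact

lemma sq_integrable_add:
  assumes "sq_integrable M X" "sq_integrable M Y"
  shows "sq_integrable M (\<lambda>\<omega>. X \<omega> + Y \<omega>)"
proof (rule sq_integrable_bound)
  note [measurable] = sq_integrableD(1)[OF assms(1)] sq_integrableD(1)[OF assms(2)]
  show "(\<lambda>\<omega>. X \<omega> + Y \<omega>) \<in> borel_measurable M" by measurable
  show "integrable M (\<lambda>\<omega>. 2 * (norm (X \<omega>))\<^sup>2 + 2 * (norm (Y \<omega>))\<^sup>2)"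
    using sq_integrableD(2)[OF assms(1)] sq_integrableD(2)[OF assms(2)] by simp
  show "(norm (X \<omega> + Y \<omega>))\<^sup>2 \<le> 2 * (norm (X \<omega>))\<^sup>2 + 2 * (norm (Y \<omega>))\<^sup>2" for \<omega>
    using norm_add_sq_le_Young[of 1 "X \<omega>" "Y \<omega>"] by simp
qed

lemma sq_integrable_scaleR:
  assumes "sq_integrable M X"
  shows "sq_integrable M (\<lambda>\<omega>. c *\<^sub>R X \<omega>)"
  using sq_integrableD[OF assms] by (auto simp: sq_integrable_def power_mult_distrib)

lemma sq_integrable_diff:
  assumes "sq_integrable M X" "sq_integrable M Y"
  shows "sq_integrable M (\<lambda>\<omega>. X \<omega> - Y \<omega>)"
  using sq_integrable_add[OF assms(1) sq_integrable_scaleR[OF assms(2), of "-1"]] by simp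

lemma integrable_avg:
  fixes X :: "nat \<Rightarrow> 'w \<Rightarrow> real"
  assumes "\<And>i. i \<in> {1..n} \<Longrightarrow> integrable M (X i)"
  shows "integrable M (\<lambda>\<omega>. avg n (\<lambda>i. X i \<omega>))"
  unfolding avg_def by (intro integrable_scaleR_right Bochner_Integration.integrable_sum assms)

lemma integral_avg:
  fixes X :: "nat \<Rightarrow> 'w \<Rightarrow> real"
  assumes "\<And>i. i \<in> {1..n} \<Longrightarrow> integrable M (X i)"
  shows "(LINT \<omega>|M. avg n (\<lambda>i. X i \<omega>)) = avg n (\<lambda>i. LINT \<omega>|M. X i \<omega>)"
  unfolding avg_def integral_scaleR_right using assms by (subst Bochner_Integration.integral_sum) auto

lemma sq_integrable_avg:
  assumes "\<And>i. i \<in> {1..n} \<Longrightarrow> sq_integrable M (X i)"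
  shows "sq_integrable M (\<lambda>\<omega>. avg n (\<lambda>i. X i \<omega>))"
proof (rule sq_integrable_bound)
  have [measurable]: "X i \<in> borel_measurable M" if "i \<in> {1..n}" for i
    using sq_integrableD(1)[OF assms[OF that]] .
  show "(\<lambda>\<omega>. avg n (\<lambda>i. X i \<omega>)) \<in> borel_measurable M"
    unfolding avg_def by measurable
  show "integrable M (\<lambda>\<omega>. avg n (\<lambda>i. (norm (X i \<omega>))\<^sup>2))"
    by (intro integrable_avg sq_integrableD(2) assms)
qed (rule norm_avg_le)

lemma (in prob_space) sq_integrable_imp_integrable:
  assumes "sq_integrable M X"
  shows "integrable M X"
proof (rule Bochner_Integration.integrable_bound)
  show "integrable M (\<lambda>\<omega>. 1 + (norm (X \<omega>))\<^sup>2)"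
    using sq_integrableD(2)[OF assms] by simp
  have "norm x \<le> 1 + (norm x)\<^sup>2" for x :: 'b
    using sum_power2_ge_zero[of "norm x - 1" 0] by (simp add: power2_eq_square algebra_simps) (smt (verit) norm_ge_zero zero_le_square)
  then show "AE \<omega> in M. norm (X \<omega>) \<le> norm (1 + (norm (X \<omega>))\<^sup>2)"
    by (auto intro!: AE_I2 order_trans[OF _ abs_ge_self])
qed (fact sq_integrableD(1)[OF assms])

lemma (in finite_measure_subalgebra) vec_cond_exp_F_meas:
  assumes "integrable M X" "X \<in> borel_measurable F"
  shows "AE \<omega> in M. vec_cond_exp M F X \<omega> = X \<omega>"
proof -
  have "AE \<omega> in M. \<forall>b\<in>Basis. real_cond_exp M F (\<lambda>\<omega>'. X \<omega>' \<bullet> b) \<omega> = X \<omega> \<bullet> b"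
    by (rule AE_finite_allI) (use assms in auto)
  then show ?thesis
    by eventually_elim (simp add: vec_cond_exp_def euclidean_representation)
qed

section \<open>Fresh randomness\<close>

lemma space_past: "space (past M S n \<xi> k) = space M"
  by (auto simp: past_def space_measure_of_conv)

lemma sets_past:
  "sets (past M S n \<xi> k) =
    sigma_sets (space M) {\<xi> i j -` A \<inter> space M | i j A. i \<in> {1..n} \<and> j < k \<and> A \<in> sets S}"
  unfolding past_def by (rule sets_measure_of) auto

context prob_space
begin

lemma fresh_seeds_measurable:
  assumes "fresh_seeds M S n \<xi>" "i \<in> {1..n}"
  shows "\<xi> i k \<in> measurable M S"
  using assms by (auto simp: fresh_seeds_def indep_vars_def2)

lemma subalgebra_past:
  assumes "fresh_seeds M S n \<xi>"
  shows "subalgebra M (past M S n \<xi> k)"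
  unfolding subalgebra_def space_past sets_past
  using fresh_seeds_measurable[OF assms] by (auto intro!: sets.sigma_sets_subset intro: measurable_sets)

lemma subalgebra_past_Suc: "subalgebra (past M S n \<xi> (Suc k)) (past M S n \<xi> k)"
  unfolding subalgebra_def space_past sets_past
  by (auto intro!: sigma_sets_mono') (metis less_SucI)

lemma seed_measurable_past:
  assumes "fresh_seeds M S n \<xi>" "i \<in> {1..n}" "j < k"
  shows "\<xi> i j \<in> measurable (past M S n \<xi> k) S"
proof (rule measurableI)
  fix \<omega> assume "\<omega> \<in> space (past M S n \<xi> k)"
  then show "\<xi> i j \<omega> \<in> space S"
    using fresh_seeds_measurable[OF assms(1,2)] by (auto simp: space_past dest: measurable_space)
next
  fix A assume "A \<in> sets S"
  then show "\<xi> i j -` A \<inter> space (past M S n \<xi> k) \<in> sets (past M S n \<xi> k)"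
    unfolding space_past sets_past using assms by (intro sigma_sets.Basic) blast
qed

text \<open>The current state is a function of earlier seeds, so together with a seed drawn now it has a
  product distribution. The product form, rather than \<open>indep_var\<close>, is used because state and seed
  take values in different types.\<close>

lemma joint_distr_past_seed:
  assumes fresh: "fresh_seeds M S n \<xi>" and i: "i \<in> {1..n}"
    and a: "a \<in> measurable (past M S n \<xi> k) N"
  shows "distr M (N \<Otimes>\<^sub>M S) (\<lambda>\<omega>. (a \<omega>, \<xi> i k \<omega>)) = distr M N a \<Otimes>\<^sub>M S"
proof -
  define E where "E = (\<lambda>(i, k). {\<xi> i k -` A \<inter> space M | A. A \<in> sets S})"
  \<comment> \<open>The two groups of seeds to be separated: those drawn before iteration k, and the one drawn now.\<close>
  define I where "I = case_bool ({1..n} \<times> {..<k}) {(i, k)}"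
  have E: "indep_sets E ({1..n} \<times> UNIV)"
    using fresh unfolding fresh_seeds_def indep_vars_def2 E_def by (simp add: case_prod_beta')
  have "indep_sets (\<lambda>b. sigma_sets (space M) (\<Union>p\<in>I b. E p)) UNIV"
  proof (rule indep_sets_collect_sigma)
    show "indep_sets E (\<Union>b. I b)"
      using i by (intro indep_sets_mono_index[OF _ E]) (auto simp: I_def split: bool.splits)
    show "Int_stable (E p)" for p
    proof (cases p)
      case (Pair i k)
      have "\<xi> i k -` A \<inter> space M \<inter> (\<xi> i k -` B \<inter> space M) \<in> E (i, k)"
        if "A \<in> sets S" "B \<in> sets S" for A B
        using that by (auto simp: E_def intro!: exI[of _ "A \<inter> B"])
      then show ?thesis unfolding Pair E_def Int_stable_def by auto
    qed
    show "disjoint_family_on I UNIV"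
      by (auto simp: disjoint_family_on_def I_def split: bool.splits)
  qed
  then have indep: "indep_set (sets (past M S n \<xi> k)) (sigma_sets (space M) {\<xi> i k -` A \<inter> space M | A. A \<in> sets S})"
    unfolding indep_set_def
  proof (rule indep_sets_mono_sets)
    have "(\<Union>p\<in>I True. E p) = {\<xi> i j -` A \<inter> space M | i j A. i \<in> {1..n} \<and> j < k \<and> A \<in> sets S}"
      unfolding I_def E_def bool.case 
      by (rule set_eqI) (simp add: Bex_def, blast)
    moreover have "(\<Union>p\<in>I False. E p) = {\<xi> i k -` A \<inter> space M | A. A \<in> sets S}"
      by (auto simp: I_def E_def)
    ultimately show "case_bool (sets (past M S n \<xi> k)) (sigma_sets (space M) {\<xi> i k -` A \<inter> space M | A. A \<in> sets S}) b
        \<subseteq> sigma_sets (space M) (\<Union>p\<in>I b. E p)" for b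
      by (cases b) (simp_all add: sets_past)
  qed
  have a_meas [measurable]: "a \<in> measurable M N"
    using a by (rule measurable_from_subalg[OF subalgebra_past[OF fresh]])
  have seed_meas [measurable]: "\<xi> i k \<in> measurable M S"
    by (rule fresh_seeds_measurable[OF fresh i])
  have seed_distr: "distr M S (\<xi> i k) = S"
    using fresh i by (simp add: fresh_seeds_def)
  have "distr M N a \<Otimes>\<^sub>M distr M S (\<xi> i k) = distr M (N \<Otimes>\<^sub>M S) (\<lambda>\<omega>. (a \<omega>, \<xi> i k \<omega>))"
  proof (rule pair_measure_eqI)
    show "sigma_finite_measure (distr M N a)" "sigma_finite_measure (distr M S (\<xi> i k))"
      by (auto intro!: prob_space_imp_sigma_finite prob_space_distr a_meas seed_meas)
    show "sets (distr M N a \<Otimes>\<^sub>M distr M S (\<xi> i k)) = sets (distr M (N \<Otimes>\<^sub>M S) (\<lambda>\<omega>. (a \<omega>, \<xi> i k \<omega>)))"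
      by (simp only: sets_distr cong: sets_pair_measure_cong)
    fix A B assume "A \<in> sets (distr M N a)" "B \<in> sets (distr M S (\<xi> i k))"
    then have A [measurable]: "A \<in> sets N" and B [measurable]: "B \<in> sets S" by simp_all
    have "a -` A \<inter> space M \<in> sets (past M S n \<xi> k)"
      using measurable_sets[OF a A] by (simp add: space_past)
    moreover have "\<xi> i k -` B \<inter> space M \<in> sigma_sets (space M) {\<xi> i k -` A \<inter> space M | A. A \<in> sets S}"
      using B by (intro sigma_sets.Basic) blast
    ultimately have "prob ((a -` A \<inter> space M) \<inter> (\<xi> i k -` B \<inter> space M))
        = prob (a -` A \<inter> space M) * prob (\<xi> i k -` B \<inter> space M)"
      by (rule indep_setD[OF indep])
    moreover have "(\<lambda>\<omega>. (a \<omega>, \<xi> i k \<omega>)) -` (A \<times> B) \<inter> space M = (a -` A \<inter> space M) \<inter> (\<xi> i k -` B \<inter> space M)"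
      by blast
    ultimately show "emeasure (distr M N a) A * emeasure (distr M S (\<xi> i k)) B
        = emeasure (distr M (N \<Otimes>\<^sub>M S) (\<lambda>\<omega>. (a \<omega>, \<xi> i k \<omega>))) (A \<times> B)"
      by (simp add: emeasure_distr emeasure_eq_measure ennreal_mult)
  qed
  then show ?thesis unfolding seed_distr ..
qed

text \<open>The contraction property of a compressor is stated for deterministic arguments. For a random
  argument independent of the seed, Fubini's theorem allows the seed to be integrated out first.
  Nonnegative integrals carry the computation, so that integrability is obtained along the way.\<close>

lemma compressor_error_contraction:
  assumes C: "compressor \<delta> S C" and a: "sq_integrable M a" and s_meas [measurable]: "s \<in> measurable M S"
    and joint: "distr M (borel \<Otimes>\<^sub>M S) (\<lambda>\<omega>. (a \<omega>, s \<omega>)) = distr M borel a \<Otimes>\<^sub>M S"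
  shows "sq_integrable M (\<lambda>\<omega>. a \<omega> - C (s \<omega>) (a \<omega>))"
    and "(LINT \<omega>|M. (norm (a \<omega> - C (s \<omega>) (a \<omega>)))\<^sup>2) \<le> (1 - \<delta>) * (LINT \<omega>|M. (norm (a \<omega>))\<^sup>2)"
proof -
  interpret S: prob_space S using C by (simp add: compressor_def)
  have C_meas [measurable]: "(\<lambda>(t, y). C t y) \<in> borel_measurable (S \<Otimes>\<^sub>M borel)"
    and C_int: "\<And>y. integrable S (\<lambda>t. (norm (C t y - y))\<^sup>2)"
    and C_le: "\<And>y. (LINT t|S. (norm (C t y - y))\<^sup>2) \<le> (1 - \<delta>) * (norm y)\<^sup>2"
    and \<delta>: "\<delta> \<le> 1"
    using C by (auto simp: compressor_def)
  note sq_integrableD(1)[OF a, measurable]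
  have CM [measurable]: "(\<lambda>\<omega>. C (s \<omega>) (a \<omega>)) \<in> borel_measurable M"
    using measurable_compose[OF _ C_meas, of "\<lambda>\<omega>. (s \<omega>, a \<omega>)" M] by simp
  have h_meas [measurable]: "(\<lambda>(y, t). ennreal ((norm (y - C t y))\<^sup>2)) \<in> borel_measurable (borel \<Otimes>\<^sub>M S)"
  proof -
    have [measurable]: "(\<lambda>p. C (snd p) (fst p)) \<in> borel_measurable (borel \<Otimes>\<^sub>M S)"
      using measurable_compose[OF _ C_meas, of "\<lambda>p. (snd p, fst p)" "borel \<Otimes>\<^sub>M S"] by simp
    show ?thesis unfolding case_prod_beta by measurable
  qed
  have "(\<integral>\<^sup>+\<omega>. ennreal ((norm (a \<omega> - C (s \<omega>) (a \<omega>)))\<^sup>2) \<partial>M)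
      = (\<integral>\<^sup>+p. (\<lambda>(y, t). ennreal ((norm (y - C t y))\<^sup>2)) p \<partial>(distr M (borel \<Otimes>\<^sub>M S) (\<lambda>\<omega>. (a \<omega>, s \<omega>))))"
    by (subst nn_integral_distr) simp_all
  also have "\<dots> = (\<integral>\<^sup>+y. \<integral>\<^sup>+t. ennreal ((norm (y - C t y))\<^sup>2) \<partial>S \<partial>(distr M borel a))"
    unfolding joint by (subst S.nn_integral_fst[symmetric]) simp_all
  also have "\<dots> \<le> (\<integral>\<^sup>+y. ennreal ((1 - \<delta>) * (norm y)\<^sup>2) \<partial>(distr M borel a))"
  proof (rule nn_integral_mono)
    fix y
    have "(\<integral>\<^sup>+t. ennreal ((norm (y - C t y))\<^sup>2) \<partial>S) = ennreal (LINT t|S. (norm (C t y - y))\<^sup>2)"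
      using C_int[of y] by (subst nn_integral_eq_integral[symmetric]) (simp_all add: norm_minus_commute)
    then show "(\<integral>\<^sup>+t. ennreal ((norm (y - C t y))\<^sup>2) \<partial>S) \<le> ennreal ((1 - \<delta>) * (norm y)\<^sup>2)"
      using C_le[of y] by (simp add: ennreal_leI)
  qed
  also have "\<dots> = (\<integral>\<^sup>+\<omega>. ennreal ((1 - \<delta>) * (norm (a \<omega>))\<^sup>2) \<partial>M)"
    by (subst nn_integral_distr) simp_all
  also have "\<dots> = ennreal ((1 - \<delta>) * (LINT \<omega>|M. (norm (a \<omega>))\<^sup>2))"
    using sq_integrableD(2)[OF a] \<delta> by (subst nn_integral_eq_integral) simp_all
  finally have le: "(\<integral>\<^sup>+\<omega>. ennreal ((norm (a \<omega> - C (s \<omega>) (a \<omega>)))\<^sup>2) \<partial>M)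
      \<le> ennreal ((1 - \<delta>) * (LINT \<omega>|M. (norm (a \<omega>))\<^sup>2))" .
  have int: "integrable M (\<lambda>\<omega>. (norm (a \<omega> - C (s \<omega>) (a \<omega>)))\<^sup>2)"
    using le by (intro integrableI_nonneg) (auto intro: le_less_trans)
  then show "sq_integrable M (\<lambda>\<omega>. a \<omega> - C (s \<omega>) (a \<omega>))"
    by (simp add: sq_integrable_def)
  have "0 \<le> (1 - \<delta>) * (LINT \<omega>|M. (norm (a \<omega>))\<^sup>2)"
    using \<delta> by (simp add: integral_nonneg)
  moreover have "(\<integral>\<^sup>+\<omega>. ennreal ((norm (a \<omega> - C (s \<omega>) (a \<omega>)))\<^sup>2) \<partial>M)
      = ennreal (LINT \<omega>|M. (norm (a \<omega> - C (s \<omega>) (a \<omega>)))\<^sup>2)"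
    using int by (intro nn_integral_eq_integral) simp_all
  ultimately show "(LINT \<omega>|M. (norm (a \<omega> - C (s \<omega>) (a \<omega>)))\<^sup>2) \<le> (1 - \<delta>) * (LINT \<omega>|M. (norm (a \<omega>))\<^sup>2)"
    using le by (simp add: ennreal_le_iff)
qed

end

section \<open>The run as a stochastic process\<close>

locale ec_gdstar_run = prob_space M
  for M :: "'w measure" +
  fixes S :: "'s measure" and n :: nat and f :: "nat \<Rightarrow> 'a::euclidean_space \<Rightarrow> real"
    and fm :: "'a \<Rightarrow> real" and xs x0 :: 'a and L \<mu> \<gamma> \<delta> :: real
    and C :: "'s \<Rightarrow> 'a \<Rightarrow> 'a" and \<xi> :: "nat \<Rightarrow> nat \<Rightarrow> 'w \<Rightarrow> 's"
    and x :: "nat \<Rightarrow> 'w \<Rightarrow> 'a" and e g v :: "nat \<Rightarrow> nat \<Rightarrow> 'w \<Rightarrow> 'a"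
  assumes n_pos: "n \<ge> 1" and L_pos: "L > 0" and mu_nonneg: "\<mu> \<ge> 0"
    and fm_def: "fm = (\<lambda>y. avg n (\<lambda>i. f i y))"
    and convex: "\<And>i. i \<in> {1..n} \<Longrightarrow> convex_on UNIV (f i)"
    and smooth: "\<And>i. i \<in> {1..n} \<Longrightarrow> L_smooth L (f i)"
    and qsc: "quasi_strongly_convex \<mu> fm xs"
    and comp: "compressor \<delta> S C" and fresh: "fresh_seeds M S n \<xi>"
    and gamma_pos: "0 < \<gamma>" and gamma_le: "\<gamma> \<le> \<delta> / (8 * L * sqrt 3)"
    and run: "EC_GDstar M n f xs x0 \<gamma> C \<xi> x e g v"
begin

abbreviation "past_at k \<equiv> past M S n \<xi> k"

definition "gap k \<omega> = fm (x k \<omega>) - fm xs"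

abbreviation "gmean k \<omega> \<equiv> avg n (\<lambda>i. g i k \<omega>)"

abbreviation "emean k \<omega> \<equiv> avg n (\<lambda>i. e i k \<omega>)"

lemma run_init:
  assumes "\<omega> \<in> space M"
  shows "x 0 \<omega> = x0" "i \<in> {1..n} \<Longrightarrow> e i 0 \<omega> = 0"
  using run assms by (auto simp: EC_GDstar_def)

lemma run_step:
  assumes "\<omega> \<in> space M"
  shows "x (Suc k) \<omega> = x k \<omega> - avg n (\<lambda>i. v i k \<omega>)"
    and "i \<in> {1..n} \<Longrightarrow> g i k \<omega> = grad (f i) (x k \<omega>) - grad (f i) xs"
    and "i \<in> {1..n} \<Longrightarrow> v i k \<omega> = C (\<xi> i k \<omega>) (e i k \<omega> + \<gamma> *\<^sub>R g i k \<omega>)"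
    and "i \<in> {1..n} \<Longrightarrow> e i (Suc k) \<omega> = e i k \<omega> + \<gamma> *\<^sub>R g i k \<omega> - v i k \<omega>"
  using run assms unfolding EC_GDstar_def by blast+

section \<open>The averaged objective\<close>

lemma fm_smooth: "L_smooth L fm"
  unfolding fm_def using smooth L_pos by (intro L_smooth_avg) auto

lemma fm_convex: "convex_on UNIV fm"
  unfolding fm_def using convex by (intro convex_on_avg) auto

lemma grad_fm: "grad fm y = avg n (\<lambda>i. grad (f i) y)"
  unfolding fm_def by (rule grad_avg) (rule smooth)

lemma fm_minimizer: "fm xs \<le> fm y"
  using qsc unfolding quasi_strongly_convex_def is_arg_min_def by (auto simp: not_less)

lemma grad_fm_minimizer: "grad fm xs = 0"
  using qsc by (intro grad_minimizer L_smoothD(1)[OF fm_smooth]) (simp add: quasi_strongly_convex_def)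

lemma qsc_inner: "fm y - fm xs + \<mu> / 2 * (norm (y - xs))\<^sup>2 \<le> grad fm y \<bullet> (y - xs)"
proof -
  have "fm xs \<ge> fm y + grad fm y \<bullet> (xs - y) + \<mu> / 2 * (norm (y - xs))\<^sup>2"
    using qsc unfolding quasi_strongly_convex_def by blast
  moreover have "grad fm y \<bullet> (xs - y) = - (grad fm y \<bullet> (y - xs))"
    by (simp add: inner_diff_right)
  ultimately show ?thesis by linarith
qed

lemma fm_gap_le: "fm y - fm xs \<le> L / 2 * (norm (y - xs))\<^sup>2"
  using L_smooth_descent[OF fm_smooth, of y xs] by (simp add: grad_fm_minimizer)

text \<open>Averaging cocoercivity at the minimizer: the linear terms add up to the gradient of the averaged
  objective at its minimizer, which vanishes.\<close>

lemma avg_grad_diff_le: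
  "avg n (\<lambda>i. (norm (grad (f i) y - grad (f i) xs))\<^sup>2) \<le> 2 * L * (fm y - fm xs)"
proof -
  have "avg n (\<lambda>i. (norm (grad (f i) y - grad (f i) xs))\<^sup>2)
      \<le> avg n (\<lambda>i. 2 * L * (f i y - f i xs - grad (f i) xs \<bullet> (y - xs)))"
    by (intro avg_mono convex_L_smooth_cocoercive convex smooth L_pos)
  also have "\<dots> = 2 * L * (fm y - fm xs - grad fm xs \<bullet> (y - xs))"
    by (simp add: avg_mult avg_diff fm_def[symmetric] grad_fm avg_inner)
       (simp add: fm_def)
  finally show ?thesis by (simp add: grad_fm_minimizer)
qed

lemma continuous_fm: "continuous_on UNIV fm"
  using L_smoothD(1)[OF fm_smooth] by (simp add: continuous_on_eq_continuous_at differentiable_imp_continuous_within)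

lemma borel_measurable_fm [measurable]: "fm \<in> borel_measurable borel"
  by (rule borel_measurable_continuous_onI) (rule continuous_fm)

lemma borel_measurable_grad:
  assumes "i \<in> {1..n}"
  shows "grad (f i) \<in> borel_measurable borel"
  using smooth[OF assms] unfolding L_smooth_def
  by (intro borel_measurable_continuous_onI lipschitz_on_continuous_on[of L]) simp

section \<open>Step-size constants\<close>

lemma delta_bounds: "0 < \<delta>" "\<delta> \<le> 1"
  using comp by (auto simp: compressor_def)

lemma gamma_L_sq: "192 * (\<gamma> * L)\<^sup>2 \<le> \<delta>\<^sup>2"
proof -
  have "\<gamma> * L * (8 * sqrt 3) \<le> \<delta>"
    using gamma_le L_pos by (simp add: pos_le_divide_eq mult_ac)
  then have "(\<gamma> * L * (8 * sqrt 3))\<^sup>2 \<le> \<delta>\<^sup>2"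
    using gamma_pos L_pos by (intro power_mono) simp_all
  then show ?thesis by (simp add: power_mult_distrib)
qed

lemma gamma_L_le: "\<gamma> * L \<le> \<delta> / 8"
proof -
  have "(8 * (\<gamma> * L))\<^sup>2 = 64 * (\<gamma> * L)\<^sup>2"
    by (subst power_mult_distrib) simp
  then have "(8 * (\<gamma> * L))\<^sup>2 \<le> \<delta>\<^sup>2"
    using gamma_L_sq zero_le_power2[of "\<gamma> * L"] by linarith
  then show ?thesis
    using power2_le_imp_le[of "8 * (\<gamma> * L)" \<delta>] delta_bounds by simp
qed

text \<open>With \<open>\<gamma> L \<le> \<delta> / 8\<close> this yields \<open>\<gamma> \<mu> / 2 \<le> \<delta> / 16\<close>. Hence the minimum defining \<open>ec_eta\<close> is
  attained at \<open>\<gamma> \<mu> / 2\<close>, and the weights grow slowly compared with the contraction \<open>1 - \<delta> / 2\<close>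
  of the compression error.\<close>

lemma mu_le_L: "\<mu> \<le> L"
  by (rule quasi_strong_convexity_le_smoothness[OF fm_convex fm_smooth L_pos qsc])

definition "\<eta> = \<gamma> * \<mu> / 2"

lemma eta_bounds: "0 \<le> \<eta>" "\<eta> \<le> \<delta> / 16" "\<eta> < 1"
proof -
  show "0 \<le> \<eta>" using gamma_pos mu_nonneg by (simp add: \<eta>_def)
  have "\<gamma> * \<mu> \<le> \<gamma> * L" using mu_le_L gamma_pos by simp
  then show "\<eta> \<le> \<delta> / 16" using gamma_L_le by (simp add: \<eta>_def)
  then show "\<eta> < 1" using delta_bounds by simp
qed

lemma ec_eta_eq: "ec_eta \<gamma> \<mu> 1 1 = \<eta>"
  using eta_bounds delta_bounds by (simp add: ec_eta_def \<eta>_def min_def)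

section \<open>Measurability and square integrability of the iterates\<close>

lemma subalg: "subalgebra M (past_at k)"
  by (rule subalgebra_past[OF fresh])

lemma compressor_measurable:
  assumes [measurable]: "s \<in> measurable N S" "a \<in> borel_measurable N"
  shows "(\<lambda>\<omega>. C (s \<omega>) (a \<omega>)) \<in> borel_measurable N"
proof -
  have "(\<lambda>(t, y). C t y) \<in> borel_measurable (S \<Otimes>\<^sub>M borel)"
    using comp by (simp add: compressor_def)
  from measurable_compose[OF _ this, of "\<lambda>\<omega>. (s \<omega>, a \<omega>)" N] show ?thesis by simp
qed

text \<open>The recursion describes the process only on \<open>space M\<close>, so measurability is transferred
  from the recursive expressions by \<open>measurable_cong\<close>.\<close>

lemma state_measurable_past:
  "x k \<in> borel_measurable (past_at k) \<and> (\<forall>i\<in>{1..n}. e i k \<in> borel_measurable (past_at k))"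
proof (induction k)
  case 0
  have "x 0 \<in> borel_measurable (past_at 0) \<longleftrightarrow> (\<lambda>_. x0) \<in> borel_measurable (past_at 0)"
    by (rule measurable_cong) (simp add: space_past run_init)
  moreover have "e i 0 \<in> borel_measurable (past_at 0) \<longleftrightarrow> (\<lambda>_. 0 :: 'a) \<in> borel_measurable (past_at 0)"
    if "i \<in> {1..n}" for i
    by (rule measurable_cong) (use that in \<open>simp add: space_past run_init\<close>)
  ultimately show ?case by simp
next
  case (Suc k)
  let ?F = "past_at (Suc k)"
  have x [measurable]: "x k \<in> borel_measurable ?F"
    using Suc.IH by (intro measurable_from_subalg[OF subalgebra_past_Suc]) blast
  have a: "(\<lambda>\<omega>. e i k \<omega> + \<gamma> *\<^sub>R (grad (f i) (x k \<omega>) - grad (f i) xs)) \<in> borel_measurable ?F"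
    if "i \<in> {1..n}" for i
  proof -
    have [measurable]: "e i k \<in> borel_measurable ?F"
      using Suc.IH that by (intro measurable_from_subalg[OF subalgebra_past_Suc]) blast
    note borel_measurable_grad[OF that, measurable]
    show ?thesis by measurable
  qed
  have v: "(\<lambda>\<omega>. C (\<xi> i k \<omega>) (e i k \<omega> + \<gamma> *\<^sub>R (grad (f i) (x k \<omega>) - grad (f i) xs))) \<in> borel_measurable ?F"
    if "i \<in> {1..n}" for i
    using seed_measurable_past[OF fresh that] a[OF that] by (intro compressor_measurable) auto
  have "x (Suc k) \<in> borel_measurable ?F \<longleftrightarrow>
      (\<lambda>\<omega>. x k \<omega> - avg n (\<lambda>i. C (\<xi> i k \<omega>) (e i k \<omega> + \<gamma> *\<^sub>R (grad (f i) (x k \<omega>) - grad (f i) xs))))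
        \<in> borel_measurable ?F"
    by (rule measurable_cong) (auto simp: space_past run_step(1-3) intro!: avg_cong)
  moreover have "\<dots>"
    unfolding avg_def
    by (intro borel_measurable_diff borel_measurable_scaleR borel_measurable_sum v x borel_measurable_const)
  moreover have "e i (Suc k) \<in> borel_measurable ?F" if "i \<in> {1..n}" for i
  proof -
    have "e i (Suc k) \<in> borel_measurable ?F \<longleftrightarrow>
        (\<lambda>\<omega>. e i k \<omega> + \<gamma> *\<^sub>R (grad (f i) (x k \<omega>) - grad (f i) xs)
           - C (\<xi> i k \<omega>) (e i k \<omega> + \<gamma> *\<^sub>R (grad (f i) (x k \<omega>) - grad (f i) xs))) \<in> borel_measurable ?F"
      by (rule measurable_cong) (use that in \<open>simp add: space_past run_step(2-4)\<close>)
    then show ?thesis using borel_measurable_diff[OF a[OF that] v[OF that]] by blast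
  qed
  ultimately show ?case by blast
qed

lemma x_measurable_past: "x k \<in> borel_measurable (past_at k)"
  using state_measurable_past by blast

lemma e_measurable_past: "i \<in> {1..n} \<Longrightarrow> e i k \<in> borel_measurable (past_at k)"
  using state_measurable_past by blast

lemma g_measurable_past:
  assumes "i \<in> {1..n}"
  shows "g i k \<in> borel_measurable (past_at k)"
proof -
  note [measurable] = x_measurable_past borel_measurable_grad[OF assms]
  have "g i k \<in> borel_measurable (past_at k) \<longleftrightarrow>
      (\<lambda>\<omega>. grad (f i) (x k \<omega>) - grad (f i) xs) \<in> borel_measurable (past_at k)"
    by (rule measurable_cong) (simp add: space_past run_step(2)[OF _ assms])
  also have "\<dots>" by measurable
  finally show ?thesis by simp
qed

lemma gmean_measurable_past: "gmean k \<in> borel_measurable (past_at k)"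
  unfolding avg_def
  by (intro borel_measurable_scaleR borel_measurable_sum g_measurable_past borel_measurable_const)

lemma measurable_past_imp: "X \<in> borel_measurable (past_at k) \<Longrightarrow> X \<in> borel_measurable M"
  by (rule measurable_from_subalg[OF subalg])

lemma g_sq_integrable_if:
  assumes "i \<in> {1..n}" "sq_integrable M (\<lambda>\<omega>. x k \<omega> - xs)"
  shows "sq_integrable M (g i k)"
proof (rule sq_integrable_bound)
  show "g i k \<in> borel_measurable M"
    using g_measurable_past[OF assms(1)] by (rule measurable_past_imp)
  show "integrable M (\<lambda>\<omega>. L\<^sup>2 * (norm (x k \<omega> - xs))\<^sup>2)"
    using sq_integrableD(2)[OF assms(2)] by simp
  fix \<omega> assume "\<omega> \<in> space M"
  then have "norm (g i k \<omega>) \<le> L * norm (x k \<omega> - xs)"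
    using L_smoothD(2)[OF smooth[OF assms(1)]] by (simp add: run_step(2)[OF _ assms(1)])
  then have "(norm (g i k \<omega>))\<^sup>2 \<le> (L * norm (x k \<omega> - xs))\<^sup>2"
    by (intro power_mono) simp_all
  then show "(norm (g i k \<omega>))\<^sup>2 \<le> L\<^sup>2 * (norm (x k \<omega> - xs))\<^sup>2"
    by (simp add: power_mult_distrib)
qed

text \<open>The new error of a worker is the compression error of \<open>e i k + \<gamma> g i k\<close>, an argument determined by
  the past and therefore independent of the seed in use.\<close>

lemma error_step:
  assumes i: "i \<in> {1..n}" and "sq_integrable M (e i k)" "sq_integrable M (g i k)"
  shows "sq_integrable M (e i (Suc k))"
    and "(LINT \<omega>|M. (norm (e i (Suc k) \<omega>))\<^sup>2) \<le> (1 - \<delta>) * (LINT \<omega>|M. (norm (e i k \<omega> + \<gamma> *\<^sub>R g i k \<omega>))\<^sup>2)"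
proof -
  let ?a = "\<lambda>\<omega>. e i k \<omega> + \<gamma> *\<^sub>R g i k \<omega>"
  have sq: "sq_integrable M ?a"
    by (intro sq_integrable_add sq_integrable_scaleR assms)
  have "?a \<in> borel_measurable (past_at k)"
    using e_measurable_past[OF i, of k] g_measurable_past[OF i, of k] by measurable
  note joint = joint_distr_past_seed[OF fresh i this]
  have eq: "e i (Suc k) \<omega> = ?a \<omega> - C (\<xi> i k \<omega>) (?a \<omega>)" if "\<omega> \<in> space M" for \<omega>
    using that by (simp add: run_step(3,4)[OF _ i])
  note contr = compressor_error_contraction[OF comp sq fresh_seeds_measurable[OF fresh i] joint]
  show "sq_integrable M (e i (Suc k))"
  proof (rule sq_integrable_bound)
    show "e i (Suc k) \<in> borel_measurable M"
      by (rule measurable_past_imp[OF e_measurable_past[OF i]])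
    show "integrable M (\<lambda>\<omega>. (norm (?a \<omega> - C (\<xi> i k \<omega>) (?a \<omega>)))\<^sup>2)"
      by (rule sq_integrableD(2)[OF contr(1)])
  qed (simp add: eq)
  have "(LINT \<omega>|M. (norm (e i (Suc k) \<omega>))\<^sup>2) = (LINT \<omega>|M. (norm (?a \<omega> - C (\<xi> i k \<omega>) (?a \<omega>)))\<^sup>2)"
    by (rule Bochner_Integration.integral_cong) (simp_all add: eq)
  then show "(LINT \<omega>|M. (norm (e i (Suc k) \<omega>))\<^sup>2) \<le> (1 - \<delta>) * (LINT \<omega>|M. (norm (?a \<omega>))\<^sup>2)"
    using contr(2) by simp
qed

lemma state_sq_integrable:
  "sq_integrable M (\<lambda>\<omega>. x k \<omega> - xs) \<and> (\<forall>i\<in>{1..n}. sq_integrable M (e i k))"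
proof (induction k)
  case 0
  have "sq_integrable M (\<lambda>\<omega>. x 0 \<omega> - xs)"
    using measurable_past_imp[OF x_measurable_past, of 0]
    by (intro sq_integrable_bound[where h = "\<lambda>_. (norm (x0 - xs))\<^sup>2"]) (simp_all add: run_init)
  moreover have "sq_integrable M (e i 0)" if "i \<in> {1..n}" for i
    using measurable_past_imp[OF e_measurable_past[OF that], of 0]
    by (intro sq_integrable_bound[where h = "\<lambda>_. 0"]) (use that in \<open>simp_all add: run_init\<close>)
  ultimately show ?case by blast
next
  case (Suc k)
  then have xk: "sq_integrable M (\<lambda>\<omega>. x k \<omega> - xs)" and ek: "\<And>i. i \<in> {1..n} \<Longrightarrow> sq_integrable M (e i k)"
    by auto
  have gk: "sq_integrable M (g i k)" if "i \<in> {1..n}" for i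
    by (rule g_sq_integrable_if[OF that xk])
  have eS: "sq_integrable M (e i (Suc k))" if "i \<in> {1..n}" for i
    by (rule error_step(1)[OF that ek[OF that] gk[OF that]])
  \<comment> \<open>The transmitted v is expressed through the errors, whose square integrability is already known.\<close>
  let ?y = "\<lambda>\<omega>. x k \<omega> - xs - avg n (\<lambda>i. e i k \<omega> + \<gamma> *\<^sub>R g i k \<omega> - e i (Suc k) \<omega>)"
  have y: "sq_integrable M ?y"
    by (intro sq_integrable_diff sq_integrable_avg sq_integrable_add sq_integrable_scaleR xk ek gk eS)
  have eq: "x (Suc k) \<omega> - xs = ?y \<omega>" if "\<omega> \<in> space M" for \<omega>
  proof -
    have "avg n (\<lambda>i. v i k \<omega>) = avg n (\<lambda>i. e i k \<omega> + \<gamma> *\<^sub>R g i k \<omega> - e i (Suc k) \<omega>)"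
      by (rule avg_cong) (simp add: run_step(4) that)
    then show ?thesis by (simp add: run_step(1) that)
  qed
  have "sq_integrable M (\<lambda>\<omega>. x (Suc k) \<omega> - xs)"
  proof (rule sq_integrable_bound[OF _ sq_integrableD(2)[OF y]])
    show "(\<lambda>\<omega>. x (Suc k) \<omega> - xs) \<in> borel_measurable M"
      using measurable_past_imp[OF x_measurable_past, of "Suc k"] by measurable
  qed (simp only: eq order_refl)
  then show ?case using eS by blast
qed

lemma x_sq_integrable: "sq_integrable M (\<lambda>\<omega>. x k \<omega> - xs)"
  and e_sq_integrable: "i \<in> {1..n} \<Longrightarrow> sq_integrable M (e i k)"
  using state_sq_integrable by blast+

lemma g_sq_integrable: "i \<in> {1..n} \<Longrightarrow> sq_integrable M (g i k)"
  by (rule g_sq_integrable_if[OF _ x_sq_integrable])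

lemma emean_sq_integrable: "sq_integrable M (emean k)"
  by (intro sq_integrable_avg e_sq_integrable)

lemma gmean_sq_integrable: "sq_integrable M (gmean k)"
  by (intro sq_integrable_avg g_sq_integrable)

lemma gap_nonneg: "0 \<le> gap k \<omega>"
  using fm_minimizer by (simp add: gap_def)

lemma gap_integrable: "integrable M (gap k)"
proof (rule Bochner_Integration.integrable_bound)
  show "integrable M (\<lambda>\<omega>. L / 2 * (norm (x k \<omega> - xs))\<^sup>2)"
    using sq_integrableD(2)[OF x_sq_integrable, of k] by simp
  show "gap k \<in> borel_measurable M"
    unfolding gap_def using measurable_past_imp[OF x_measurable_past, of k] by measurable
  show "AE \<omega> in M. norm (gap k \<omega>) \<le> norm (L / 2 * (norm (x k \<omega> - xs))\<^sup>2)"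
    using gap_nonneg fm_gap_le L_pos by (intro AE_I2) (simp add: gap_def)
qed

section \<open>One-step estimates\<close>

lemma avg_g_sq_le:
  assumes "\<omega> \<in> space M"
  shows "avg n (\<lambda>i. (norm (g i k \<omega>))\<^sup>2) \<le> 2 * L * gap k \<omega>"
proof -
  have "avg n (\<lambda>i. (norm (g i k \<omega>))\<^sup>2) = avg n (\<lambda>i. (norm (grad (f i) (x k \<omega>) - grad (f i) xs))\<^sup>2)"
    by (rule avg_cong) (simp add: run_step(2) assms)
  then show ?thesis using avg_grad_diff_le by (simp add: gap_def)
qed

lemma gmean_sq_le:
  assumes "\<omega> \<in> space M"
  shows "(norm (gmean k \<omega>))\<^sup>2 \<le> 2 * L * gap k \<omega>"
  using norm_avg_le avg_g_sq_le[OF assms] by (rule order_trans)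

lemma gmean_eq_grad:
  assumes "\<omega> \<in> space M"
  shows "gmean k \<omega> = grad fm (x k \<omega>)"
proof -
  have "gmean k \<omega> = avg n (\<lambda>i. grad (f i) (x k \<omega>) - grad (f i) xs)"
    by (rule avg_cong) (simp add: run_step(2) assms)
  also have "\<dots> = grad fm (x k \<omega>) - grad fm xs"
    by (simp add: avg_diff grad_fm)
  finally show ?thesis by (simp add: grad_fm_minimizer)
qed

text \<open>The mean squared error of the individual workers dominates the squared mean error and, unlike
  the latter, satisfies a recursion: the contraction holds per worker.\<close>

definition "err k = avg n (\<lambda>i. LINT \<omega>|M. (norm (e i k \<omega>))\<^sup>2)"

lemma err_nonneg: "0 \<le> err k"
  unfolding err_def avg_def real_scaleR_def by (intro mult_nonneg_nonneg sum_nonneg integral_nonneg) simp_all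

lemma err_0: "err 0 = 0"
proof -
  have "(LINT \<omega>|M. (norm (e i 0 \<omega>))\<^sup>2) = (LINT \<omega>|M. 0)" if "i \<in> {1..n}" for i
    by (rule Bochner_Integration.integral_cong) (use that in \<open>simp_all add: run_init\<close>)
  then show ?thesis by (simp add: err_def avg_def)
qed

lemma emean_sq_le_err: "(LINT \<omega>|M. (norm (emean k \<omega>))\<^sup>2) \<le> err k"
proof -
  have ei: "integrable M (\<lambda>\<omega>. (norm (e i k \<omega>))\<^sup>2)" if "i \<in> {1..n}" for i
    by (intro sq_integrableD(2) e_sq_integrable that)
  have "(LINT \<omega>|M. (norm (emean k \<omega>))\<^sup>2) \<le> (LINT \<omega>|M. avg n (\<lambda>i. (norm (e i k \<omega>))\<^sup>2))"
    by (intro integral_mono sq_integrableD(2) emean_sq_integrable integrable_avg ei norm_avg_le)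
  also have "\<dots> = err k"
    unfolding err_def by (intro integral_avg ei)
  finally show ?thesis .
qed

text \<open>Young's inequality with parameter \<open>\<delta> / 2\<close> keeps half of the contraction: the factors become
  \<open>(1 - \<delta>) (1 + \<delta> / 2) \<le> 1 - \<delta> / 2\<close> and \<open>(1 - \<delta>) (1 + 2 / \<delta>) \<le> 2 / \<delta>\<close>.\<close>

lemma worker_error_recursion:
  assumes i: "i \<in> {1..n}"
  shows "(LINT \<omega>|M. (norm (e i (Suc k) \<omega>))\<^sup>2)
    \<le> (1 - \<delta> / 2) * (LINT \<omega>|M. (norm (e i k \<omega>))\<^sup>2) + 2 * \<gamma>\<^sup>2 / \<delta> * (LINT \<omega>|M. (norm (g i k \<omega>))\<^sup>2)"
proof -
  note ei = sq_integrableD(2)[OF e_sq_integrable[OF i, of k]]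
  note gi = sq_integrableD(2)[OF g_sq_integrable[OF i, of k]]
  let ?E = "LINT \<omega>|M. (norm (e i k \<omega>))\<^sup>2" and ?G = "LINT \<omega>|M. (norm (g i k \<omega>))\<^sup>2"
  have "(LINT \<omega>|M. (norm (e i k \<omega> + \<gamma> *\<^sub>R g i k \<omega>))\<^sup>2)
      \<le> (LINT \<omega>|M. (1 + \<delta> / 2) * (norm (e i k \<omega>))\<^sup>2 + (1 + 2 / \<delta>) * (\<gamma>\<^sup>2 * (norm (g i k \<omega>))\<^sup>2))"
  proof (rule integral_mono)
    show "integrable M (\<lambda>\<omega>. (norm (e i k \<omega> + \<gamma> *\<^sub>R g i k \<omega>))\<^sup>2)"
      by (intro sq_integrableD(2) sq_integrable_add sq_integrable_scaleR e_sq_integrable g_sq_integrable i)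
    show "integrable M (\<lambda>\<omega>. (1 + \<delta> / 2) * (norm (e i k \<omega>))\<^sup>2 + (1 + 2 / \<delta>) * (\<gamma>\<^sup>2 * (norm (g i k \<omega>))\<^sup>2))"
      using ei gi by simp
    show "(norm (e i k \<omega> + \<gamma> *\<^sub>R g i k \<omega>))\<^sup>2
        \<le> (1 + \<delta> / 2) * (norm (e i k \<omega>))\<^sup>2 + (1 + 2 / \<delta>) * (\<gamma>\<^sup>2 * (norm (g i k \<omega>))\<^sup>2)" for \<omega>
      using norm_add_sq_le_Young[of "\<delta> / 2" "e i k \<omega>" "\<gamma> *\<^sub>R g i k \<omega>"] delta_bounds
      by (simp add: power_mult_distrib)
  qed
  also have "\<dots> = (1 + \<delta> / 2) * ?E + (1 + 2 / \<delta>) * (\<gamma>\<^sup>2 * ?G)"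
    using ei gi by simp
  finally have "(1 - \<delta>) * (LINT \<omega>|M. (norm (e i k \<omega> + \<gamma> *\<^sub>R g i k \<omega>))\<^sup>2)
      \<le> (1 - \<delta>) * ((1 + \<delta> / 2) * ?E + (1 + 2 / \<delta>) * (\<gamma>\<^sup>2 * ?G))"
    using delta_bounds by (intro mult_left_mono) simp_all
  also have "\<dots> = ((1 - \<delta>) * (1 + \<delta> / 2)) * ?E + ((1 - \<delta>) * (1 + 2 / \<delta>)) * (\<gamma>\<^sup>2 * ?G)"
    by (simp add: algebra_simps)
  also have "\<dots> \<le> (1 - \<delta> / 2) * ?E + (2 / \<delta>) * (\<gamma>\<^sup>2 * ?G)"
  proof (intro add_mono mult_right_mono)
    show "(1 - \<delta>) * (1 + \<delta> / 2) \<le> 1 - \<delta> / 2"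
      using zero_le_square[of \<delta>] by (simp add: algebra_simps)
    have "(1 - \<delta>) * (1 + 2 / \<delta>) = 2 / \<delta> - 1 - \<delta>"
      using delta_bounds by (simp add: field_simps)
    then show "(1 - \<delta>) * (1 + 2 / \<delta>) \<le> 2 / \<delta>"
      using delta_bounds by simp
  qed (simp_all add: integral_nonneg)
  finally show ?thesis
    using error_step(2)[OF i e_sq_integrable[OF i] g_sq_integrable[OF i], of k] by (simp add: mult.assoc)
qed

lemma err_recursion:
  "err (Suc k) \<le> (1 - \<delta> / 2) * err k + 4 * \<gamma>\<^sup>2 * L / \<delta> * (LINT \<omega>|M. gap k \<omega>)"
proof -
  have "err (Suc k) \<le> avg n (\<lambda>i. (1 - \<delta> / 2) * (LINT \<omega>|M. (norm (e i k \<omega>))\<^sup>2)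
      + 2 * \<gamma>\<^sup>2 / \<delta> * (LINT \<omega>|M. (norm (g i k \<omega>))\<^sup>2))"
    unfolding err_def by (intro avg_mono worker_error_recursion)
  also have "\<dots> = (1 - \<delta> / 2) * err k + 2 * \<gamma>\<^sup>2 / \<delta> * avg n (\<lambda>i. LINT \<omega>|M. (norm (g i k \<omega>))\<^sup>2)"
    by (simp only: avg_add avg_mult err_def)
  also have "\<dots> \<le> (1 - \<delta> / 2) * err k + 2 * \<gamma>\<^sup>2 / \<delta> * (2 * L * (LINT \<omega>|M. gap k \<omega>))"
  proof (intro add_left_mono mult_left_mono)
    have gi: "integrable M (\<lambda>\<omega>. (norm (g i k \<omega>))\<^sup>2)" if "i \<in> {1..n}" for i
      by (intro sq_integrableD(2) g_sq_integrable that)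
    have "avg n (\<lambda>i. LINT \<omega>|M. (norm (g i k \<omega>))\<^sup>2) = (LINT \<omega>|M. avg n (\<lambda>i. (norm (g i k \<omega>))\<^sup>2))"
      by (intro integral_avg[symmetric] gi)
    also have "\<dots> \<le> (LINT \<omega>|M. 2 * L * gap k \<omega>)"
    proof (rule integral_mono)
      show "integrable M (\<lambda>\<omega>. avg n (\<lambda>i. (norm (g i k \<omega>))\<^sup>2))"
        by (intro integrable_avg gi)
      show "integrable M (\<lambda>\<omega>. 2 * L * gap k \<omega>)"
        by (intro integrable_mult_right gap_integrable)
    qed (rule avg_g_sq_le)
    also have "\<dots> = 2 * L * (LINT \<omega>|M. gap k \<omega>)"
      by simp
    finally show "avg n (\<lambda>i. LINT \<omega>|M. (norm (g i k \<omega>))\<^sup>2) \<le> 2 * L * (LINT \<omega>|M. gap k \<omega>)" .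
  qed (use delta_bounds in simp)
  finally show ?thesis by (simp add: mult_ac)
qed

lemma weight_pos: "0 < ec_weight \<eta> k"
  using eta_bounds by (simp add: ec_weight_def)

text \<open>Splitting the contraction \<open>1 - \<delta> / 2\<close> into \<open>1 - \<eta>\<close>, which the weights absorb, and a surplus of at
  least \<open>\<delta> / 2 - \<delta> / 16 = 7 \<delta> / 16\<close> bounds the weighted errors by the weighted gaps. The resulting
  factor, multiplied by \<open>3 L\<close>, is \<open>(192 / 7) (\<gamma> L / \<delta>)\<^sup>2\<close>, which the restriction on the step size
  makes at most \<open>1 / 7\<close>.\<close>

lemma weighted_err_le:
  "3 * L * (\<Sum>k=0..K. ec_weight \<eta> k * err k)
    \<le> 1 / 4 * (\<Sum>k=0..K. ec_weight \<eta> k * (LINT \<omega>|M. gap k \<omega>))"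
proof -
  let ?c = "4 * \<gamma>\<^sup>2 * L / \<delta>"
  let ?E = "\<Sum>k=0..K. ec_weight \<eta> k * err k"
  let ?T = "\<Sum>k=0..K. ec_weight \<eta> k * (LINT \<omega>|M. gap k \<omega>)"
  have E: "0 \<le> ?E"
    using weight_pos err_nonneg by (intro sum_nonneg mult_nonneg_nonneg) (auto intro: less_imp_le)
  have T: "0 \<le> ?T"
    using weight_pos gap_nonneg by (intro sum_nonneg mult_nonneg_nonneg integral_nonneg) (auto intro: less_imp_le)
  have "(\<Sum>k=0..K. ec_weight \<eta> k * ((\<delta> / 2 - \<eta>) * err k - ?c * (LINT \<omega>|M. gap k \<omega>))) \<le> err 0"
  proof (rule weighted_telescope)
    show "err (Suc k) \<le> (1 - \<eta>) * err k - ((\<delta> / 2 - \<eta>) * err k - ?c * (LINT \<omega>|M. gap k \<omega>))" for k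
      using err_recursion[of k] by (simp add: algebra_simps)
  qed (use eta_bounds err_nonneg in auto)
  also have "(\<Sum>k=0..K. ec_weight \<eta> k * ((\<delta> / 2 - \<eta>) * err k - ?c * (LINT \<omega>|M. gap k \<omega>)))
      = (\<delta> / 2 - \<eta>) * ?E - ?c * ?T"
    by (simp add: sum_distrib_left sum_subtractf right_diff_distrib mult.left_commute)
  finally have "(\<delta> / 2 - \<eta>) * ?E \<le> ?c * ?T"
    by (simp add: err_0)
  moreover have "(7 * \<delta> / 16) * ?E \<le> (\<delta> / 2 - \<eta>) * ?E"
    using eta_bounds E by (intro mult_right_mono) simp_all
  ultimately have "(7 * \<delta> / 16) * ?E \<le> ?c * ?T" by linarith
  \<comment> \<open>The factor 192 brings the step-size condition into play and avoids divisions.\<close>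
  then have "(192 * L * \<delta>) * ((7 * \<delta> / 16) * ?E) \<le> (192 * L * \<delta>) * (?c * ?T)"
    using L_pos delta_bounds by (intro mult_left_mono) simp_all
  also have "\<dots> = 4 * (192 * (\<gamma> * L)\<^sup>2) * ?T"
    using delta_bounds by (simp add: power_mult_distrib power2_eq_square)
  also have "\<dots> \<le> 4 * \<delta>\<^sup>2 * ?T"
    using gamma_L_sq T by (intro mult_right_mono mult_left_mono) simp_all
  finally have "\<delta>\<^sup>2 * (84 * L * ?E) \<le> \<delta>\<^sup>2 * (4 * ?T)"
    by (simp add: power2_eq_square mult_ac)
  then have "84 * L * ?E \<le> 4 * ?T"
    using delta_bounds by simp
  moreover have "3 * L * ?E = 84 * L * ?E / 28" by simp
  ultimately show ?thesis using T by linarith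
qed

section \<open>The virtual iterates\<close>

text \<open>The virtual iterate \<open>x k - emean k\<close> is the point that would be reached if the accumulated
  errors had been transmitted.\<close>

definition "dist_sq k \<omega> = (norm (x k \<omega> - emean k \<omega> - xs))\<^sup>2"

lemma dist_sq_integrable: "integrable M (dist_sq k)"
proof -
  have "sq_integrable M (\<lambda>\<omega>. x k \<omega> - xs - emean k \<omega>)"
    by (intro sq_integrable_diff x_sq_integrable emean_sq_integrable)
  then show ?thesis
    unfolding dist_sq_def by (auto dest: sq_integrableD(2) simp: algebra_simps)
qed

text \<open>What compression withholds from the step reappears in the error, so the virtual iterate makes an
  exact gradient step.\<close>

lemma virtual_step:
  assumes "\<omega> \<in> space M"
  shows "x (Suc k) \<omega> - emean (Suc k) \<omega> = x k \<omega> - emean k \<omega> - \<gamma> *\<^sub>R gmean k \<omega>"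
proof -
  have "emean (Suc k) \<omega> = avg n (\<lambda>i. e i k \<omega> + \<gamma> *\<^sub>R g i k \<omega> - v i k \<omega>)"
    by (rule avg_cong) (simp add: run_step(4) assms)
  then show ?thesis
    by (simp add: run_step(1) assms avg_diff avg_add avg_scaleR)
qed

text \<open>In the expansion of the squared distance after an exact step, the gradient is evaluated at \<open>x k\<close>
  and not at the virtual iterate. Quasi strong convexity at \<open>x k\<close> gains \<open>2 \<gamma>\<close> times
  the gap. The discrepancy \<open>emean k\<close> between the two points costs \<open>\<gamma>\<close> times the gap through Young's
  inequality, the squared step at most \<open>\<gamma> / 2\<close> times the gap, and replacing the distance of \<open>x k\<close>
  by that of the virtual iterate costs a multiple of the squared error.\<close>

lemma dist_sq_step:
  assumes "\<omega> \<in> space M"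
  shows "dist_sq (Suc k) \<omega> \<le> (1 - \<eta>) * dist_sq k \<omega>
    - (\<gamma> / 2 * gap k \<omega> - 3 * L * \<gamma> * (norm (emean k \<omega>))\<^sup>2)"
proof -
  define y where "y = x k \<omega> - emean k \<omega> - xs"
  define d where "d = x k \<omega> - xs"
  define h where "h = emean k \<omega>"
  define G where "G = gmean k \<omega>"
  have y: "y = d - h" by (simp add: y_def d_def h_def)
  have G2: "(norm G)\<^sup>2 \<le> 2 * L * gap k \<omega>"
    unfolding G_def by (rule gmean_sq_le[OF assms])
  have "x (Suc k) \<omega> - emean (Suc k) \<omega> - xs = y - \<gamma> *\<^sub>R G"
    using virtual_step[OF assms, of k] by (simp add: y_def G_def algebra_simps)
  then have "dist_sq (Suc k) \<omega> = (norm (y - \<gamma> *\<^sub>R G))\<^sup>2"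
    by (simp add: dist_sq_def)
  also have "\<dots> = (norm y)\<^sup>2 - 2 * \<gamma> * (y \<bullet> G) + \<gamma>\<^sup>2 * (norm G)\<^sup>2"
    by (simp add: power2_norm_eq_inner inner_diff_left inner_diff_right inner_commute)
       (simp add: power2_eq_square)
  also have "y \<bullet> G = G \<bullet> d - h \<bullet> G"
    by (simp add: y inner_diff_left inner_commute[of G])
  finally have expand: "dist_sq (Suc k) \<omega>
      = (norm y)\<^sup>2 - 2 * \<gamma> * (G \<bullet> d) + \<gamma> * (2 * (h \<bullet> G)) + \<gamma>\<^sup>2 * (norm G)\<^sup>2"
    by (simp add: algebra_simps)
  have inner: "gap k \<omega> + \<mu> / 2 * (norm d)\<^sup>2 \<le> G \<bullet> d"
    using qsc_inner[of "x k \<omega>"] by (simp add: gap_def G_def d_def gmean_eq_grad[OF assms])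
  \<comment> \<open>With parameter 2 L the gradient term is bounded by one gap.\<close>
  have "2 * (h \<bullet> G) \<le> 2 * L * (norm h)\<^sup>2 + (norm G)\<^sup>2 / (2 * L)"
    using L_pos by (intro two_inner_le_Young) simp
  also have "(norm G)\<^sup>2 / (2 * L) \<le> gap k \<omega>"
    using G2 L_pos by (simp add: pos_divide_le_eq mult_ac)
  finally have cross: "\<gamma> * (2 * (h \<bullet> G)) \<le> \<gamma> * (2 * L * (norm h)\<^sup>2 + gap k \<omega>)"
    using gamma_pos by (intro mult_left_mono) simp_all
  have "\<gamma>\<^sup>2 * (norm G)\<^sup>2 \<le> \<gamma>\<^sup>2 * (2 * L * gap k \<omega>)"
    using G2 by (intro mult_left_mono) simp_all
  also have "\<dots> = (2 * (\<gamma> * L)) * (\<gamma> * gap k \<omega>)"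
    by (simp add: power2_eq_square)
  also have "\<dots> \<le> (1 / 2) * (\<gamma> * gap k \<omega>)"
    using gamma_L_le delta_bounds gap_nonneg gamma_pos by (intro mult_right_mono) simp_all
  finally have quad: "\<gamma>\<^sup>2 * (norm G)\<^sup>2 \<le> \<gamma> / 2 * gap k \<omega>" by simp
  have "(norm y)\<^sup>2 \<le> 2 * (norm d)\<^sup>2 + 2 * (norm h)\<^sup>2"
    using norm_add_sq_le_Young[of 1 d "- h"] by (simp add: y)
  then have "\<gamma> * \<mu> / 2 * (norm y)\<^sup>2 \<le> \<gamma> * \<mu> / 2 * (2 * (norm d)\<^sup>2 + 2 * (norm h)\<^sup>2)"
    using gamma_pos mu_nonneg by (intro mult_left_mono) simp_all
  moreover have "\<gamma> * \<mu> * (norm h)\<^sup>2 \<le> \<gamma> * L * (norm h)\<^sup>2"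
    using gamma_pos mu_le_L by (intro mult_right_mono mult_left_mono) simp_all
  ultimately have contr: "\<eta> * (norm y)\<^sup>2 \<le> \<gamma> * \<mu> * (norm d)\<^sup>2 + \<gamma> * L * (norm h)\<^sup>2"
    by (simp add: \<eta>_def algebra_simps)
  have "2 * \<gamma> * (gap k \<omega> + \<mu> / 2 * (norm d)\<^sup>2) \<le> 2 * \<gamma> * (G \<bullet> d)"
    using inner gamma_pos by (intro mult_left_mono) simp_all
  then have "dist_sq (Suc k) \<omega> \<le> (1 - \<eta>) * (norm y)\<^sup>2
      - (\<gamma> / 2 * gap k \<omega> - 3 * L * \<gamma> * (norm h)\<^sup>2)"
    using expand cross quad contr by (simp add: algebra_simps)
  then show ?thesis by (simp add: dist_sq_def y_def h_def)
qed

text \<open>Telescoping leaves \<open>\<gamma> / 2\<close> times the weighted gaps minus \<open>\<gamma>\<close> times the weighted errors with factor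
  \<open>3 L\<close>. The latter consume at most half of the former, whence the constant \<open>4\<close>.\<close>

lemma weighted_gap_le:
  "(\<Sum>k=0..K. ec_weight \<eta> k * (LINT \<omega>|M. gap k \<omega>)) \<le> 4 * (norm (x0 - xs))\<^sup>2 / \<gamma>"
proof -
  let ?r = "\<lambda>k. LINT \<omega>|M. dist_sq k \<omega>"
  let ?\<Delta> = "\<lambda>k. LINT \<omega>|M. gap k \<omega>"
  let ?e = "\<lambda>k. LINT \<omega>|M. (norm (emean k \<omega>))\<^sup>2"
  let ?E = "\<Sum>k=0..K. ec_weight \<eta> k * err k"
  let ?T = "\<Sum>k=0..K. ec_weight \<eta> k * ?\<Delta> k"
  have "?r (Suc k) \<le> (1 - \<eta>) * ?r k - (\<gamma> / 2 * ?\<Delta> k - 3 * L * \<gamma> * err k)" for k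
  proof -
    note [simp] = dist_sq_integrable gap_integrable sq_integrableD(2)[OF emean_sq_integrable]
    have "?r (Suc k) \<le> (LINT \<omega>|M. (1 - \<eta>) * dist_sq k \<omega>
        - (\<gamma> / 2 * gap k \<omega> - 3 * L * \<gamma> * (norm (emean k \<omega>))\<^sup>2))"
    proof (rule integral_mono)
      show "integrable M (\<lambda>\<omega>. (1 - \<eta>) * dist_sq k \<omega>
          - (\<gamma> / 2 * gap k \<omega> - 3 * L * \<gamma> * (norm (emean k \<omega>))\<^sup>2))"
        by (intro Bochner_Integration.integrable_diff integrable_mult_right) simp_all
    qed (use dist_sq_step in simp_all)
    also have "\<dots> = (1 - \<eta>) * ?r k - (\<gamma> / 2 * ?\<Delta> k - 3 * L * \<gamma> * ?e k)"
      by (simp only: Bochner_Integration.integral_diff Bochner_Integration.integrable_diff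
          integrable_mult_right integral_mult_right_zero
          dist_sq_integrable gap_integrable sq_integrableD(2)[OF emean_sq_integrable])
    also have "\<dots> \<le> (1 - \<eta>) * ?r k - (\<gamma> / 2 * ?\<Delta> k - 3 * L * \<gamma> * err k)"
      using L_pos gamma_pos emean_sq_le_err[of k] by (simp add: mult_left_mono)
    finally show ?thesis .
  qed
  then have "(\<Sum>k=0..K. ec_weight \<eta> k * (\<gamma> / 2 * ?\<Delta> k - 3 * L * \<gamma> * err k)) \<le> ?r 0"
    by (intro weighted_telescope eta_bounds) (simp_all add: dist_sq_def integral_nonneg)
  also have "?r 0 = (LINT \<omega>|M. (norm (x0 - xs))\<^sup>2)"
  proof (rule Bochner_Integration.integral_cong)
    fix \<omega> assume \<omega>: "\<omega> \<in> space M"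
    have "emean 0 \<omega> = avg n (\<lambda>_. 0)"
      by (rule avg_cong) (simp add: run_init \<omega>)
    then show "dist_sq 0 \<omega> = (norm (x0 - xs))\<^sup>2"
      by (simp add: dist_sq_def run_init \<omega> avg_def)
  qed simp
  also have "\<dots> = (norm (x0 - xs))\<^sup>2" by (simp add: prob_space)
  also have "(\<Sum>k=0..K. ec_weight \<eta> k * (\<gamma> / 2 * ?\<Delta> k - 3 * L * \<gamma> * err k))
      = \<gamma> / 2 * ?T - \<gamma> * (3 * L * ?E)"
    by (simp add: sum_distrib_left sum_subtractf right_diff_distrib mult_ac)
  finally have "\<gamma> / 2 * ?T - \<gamma> * (3 * L * ?E) \<le> (norm (x0 - xs))\<^sup>2" .
  moreover have "\<gamma> * (3 * L * ?E) \<le> \<gamma> * (1 / 4 * ?T)"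
    using weighted_err_le gamma_pos by (intro mult_left_mono) simp_all
  ultimately have "\<gamma> * ?T \<le> 4 * (norm (x0 - xs))\<^sup>2" by linarith
  then show ?thesis using gamma_pos by (simp add: pos_le_divide_eq mult.commute)
qed

section \<open>The averaged iterate\<close>

lemma weight_sum_pos: "0 < ec_weight_sum \<eta> K"
  unfolding ec_weight_sum_def by (intro sum_pos weight_pos) auto

lemma weighted_iterate_gap_le:
  "fm (weighted_iterate \<eta> x K \<omega>) - fm xs \<le> (1 / ec_weight_sum \<eta> K) * (\<Sum>k=0..K. ec_weight \<eta> k * gap k \<omega>)"
proof -
  let ?W = "ec_weight_sum \<eta> K"
  have one: "(\<Sum>k=0..K. ec_weight \<eta> k / ?W) = 1"
    using weight_sum_pos[of K] by (simp add: sum_divide_distrib[symmetric] ec_weight_sum_def)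
  have "weighted_iterate \<eta> x K \<omega> = (\<Sum>k=0..K. (ec_weight \<eta> k / ?W) *\<^sub>R x k \<omega>)"
    by (simp add: weighted_iterate_def scaleR_sum_right)
  moreover have "fm (\<Sum>k=0..K. (ec_weight \<eta> k / ?W) *\<^sub>R x k \<omega>) \<le> (\<Sum>k=0..K. ec_weight \<eta> k / ?W * fm (x k \<omega>))"
    using weight_pos weight_sum_pos
    by (intro convex_on_sum[OF _ _ fm_convex one]) (auto intro: less_imp_le)
  moreover have "(\<Sum>k=0..K. ec_weight \<eta> k / ?W * fm (x k \<omega>)) - fm xs = (\<Sum>k=0..K. ec_weight \<eta> k / ?W * gap k \<omega>)"
    unfolding gap_def right_diff_distrib sum_subtractf sum_distrib_right[symmetric] one by simp
  ultimately show ?thesis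
    by (simp add: sum_distrib_left)
qed

lemma weighted_iterate_gap_integrable:
  "integrable M (\<lambda>\<omega>. fm (weighted_iterate \<eta> x K \<omega>) - fm xs)"
proof (rule Bochner_Integration.integrable_bound)
  show "integrable M (\<lambda>\<omega>. (1 / ec_weight_sum \<eta> K) * (\<Sum>k=0..K. ec_weight \<eta> k * gap k \<omega>))"
    by (intro integrable_mult_right Bochner_Integration.integrable_sum gap_integrable)
  have [measurable]: "x k \<in> borel_measurable M" for k
    by (rule measurable_past_imp[OF x_measurable_past])
  show "(\<lambda>\<omega>. fm (weighted_iterate \<eta> x K \<omega>) - fm xs) \<in> borel_measurable M"
    unfolding weighted_iterate_def by measurable
  show "AE \<omega> in M. norm (fm (weighted_iterate \<eta> x K \<omega>) - fm xs)
      \<le> norm ((1 / ec_weight_sum \<eta> K) * (\<Sum>k=0..K. ec_weight \<eta> k * gap k \<omega>))"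
  proof (rule AE_I2)
    fix \<omega>
    have "norm (fm (weighted_iterate \<eta> x K \<omega>) - fm xs) = fm (weighted_iterate \<eta> x K \<omega>) - fm xs"
      using fm_minimizer by simp
    also note weighted_iterate_gap_le
    also note abs_ge_self
    finally show "norm (fm (weighted_iterate \<eta> x K \<omega>) - fm xs)
      \<le> norm ((1 / ec_weight_sum \<eta> K) * (\<Sum>k=0..K. ec_weight \<eta> k * gap k \<omega>))"
      by (simp only: real_norm_def)
  qed
qed

lemma expected_gap_le:
  "(LINT \<omega>|M. fm (weighted_iterate \<eta> x K \<omega>) - fm xs)
    \<le> 1 / ec_weight_sum \<eta> K * (4 * (norm (x0 - xs))\<^sup>2 / \<gamma>)"
proof -
  have "(LINT \<omega>|M. fm (weighted_iterate \<eta> x K \<omega>) - fm xs)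
      \<le> (LINT \<omega>|M. (1 / ec_weight_sum \<eta> K) * (\<Sum>k=0..K. ec_weight \<eta> k * gap k \<omega>))"
    by (rule integral_mono[OF weighted_iterate_gap_integrable])
      (intro integrable_mult_right Bochner_Integration.integrable_sum gap_integrable, rule weighted_iterate_gap_le)
  also have "\<dots> = 1 / ec_weight_sum \<eta> K * (\<Sum>k=0..K. ec_weight \<eta> k * (LINT \<omega>|M. gap k \<omega>))"
    by (simp add: gap_integrable)
  also have "\<dots> \<le> 1 / ec_weight_sum \<eta> K * (4 * (norm (x0 - xs))\<^sup>2 / \<gamma>)"
    using weight_sum_pos by (intro mult_left_mono weighted_gap_le) (simp add: less_imp_le)
  finally show ?thesis .
qed

text \<open>The sum of the weights is at least its last term \<open>(1 - \<eta>)\<close> to the power \<open>-(K + 1)\<close>.\<close>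

lemma linear_rate:
  "(LINT \<omega>|M. fm (weighted_iterate \<eta> x K \<omega>) - fm xs) \<le> (1 - \<eta>) ^ K * (4 * (norm (x0 - xs))\<^sup>2 / \<gamma>)"
proof -
  have "ec_weight \<eta> K \<le> ec_weight_sum \<eta> K"
    unfolding ec_weight_sum_def using weight_pos by (intro member_le_sum) (auto intro: less_imp_le)
  then have "1 / ec_weight_sum \<eta> K \<le> 1 / ec_weight \<eta> K"
    using weight_pos[of K] by (intro divide_left_mono) (simp_all add: weight_sum_pos)
  also have "\<dots> = (1 - \<eta>) ^ (K + 1)"
    by (simp add: ec_weight_def)
  also have "\<dots> \<le> (1 - \<eta>) ^ K"
    using eta_bounds by (intro power_decreasing) simp_all
  finally have "1 / ec_weight_sum \<eta> K * (4 * (norm (x0 - xs))\<^sup>2 / \<gamma>) \<le> (1 - \<eta>) ^ K * (4 * (norm (x0 - xs))\<^sup>2 / \<gamma>)"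
    using gamma_pos by (intro mult_right_mono) simp_all
  with expected_gap_le show ?thesis by (rule order_trans)
qed

lemma sublinear_rate:
  assumes "\<mu> = 0" "K > 0"
  shows "(LINT \<omega>|M. fm (weighted_iterate \<eta> x K \<omega>) - fm xs) \<le> 4 * (norm (x0 - xs))\<^sup>2 / (real K * \<gamma>)"
proof -
  have "ec_weight_sum \<eta> K = real K + 1"
  proof -
    have "\<eta> = 0" by (subst \<eta>_def) (simp add: assms(1))
    then show ?thesis by (simp add: ec_weight_sum_def ec_weight_def)
  qed
  then have "1 / ec_weight_sum \<eta> K \<le> 1 / real K"
    using assms(2) by (simp add: frac_le)
  then have "1 / ec_weight_sum \<eta> K * (4 * (norm (x0 - xs))\<^sup>2 / \<gamma>) \<le> 1 / real K * (4 * (norm (x0 - xs))\<^sup>2 / \<gamma>)"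
    using gamma_pos by (intro mult_right_mono) simp_all
  with expected_gap_le[of K] show ?thesis by simp
qed

section \<open>The parametric assumption\<close>

lemma finite_measure_subalgebra_past: "finite_measure_subalgebra M (past_at k)"
  by unfold_locales (rule subalg)

text \<open>The gradients are evaluated without sampling noise, so they are determined by the past and
  conditioning has no effect.\<close>

lemma cond_exp_g:
  assumes "i \<in> {1..n}"
  shows "AE \<omega> in M. vec_cond_exp M (past_at k) (g i k) \<omega> = g i k \<omega>"
  using finite_measure_subalgebra.vec_cond_exp_F_meas[OF finite_measure_subalgebra_past
      sq_integrable_imp_integrable[OF g_sq_integrable[OF assms]] g_measurable_past[OF assms]] .

lemma cond_exp_gmean:
  "AE \<omega> in M. vec_cond_exp M (past_at k) (gmean k) \<omega> = grad fm (x k \<omega>)"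
  using finite_measure_subalgebra.vec_cond_exp_F_meas[OF finite_measure_subalgebra_past
      sq_integrable_imp_integrable[OF gmean_sq_integrable] gmean_measurable_past] AE_space
  by eventually_elim (simp add: gmean_eq_grad)

lemma real_cond_exp_past:
  assumes "integrable M X" "X \<in> borel_measurable (past_at k)"
  shows "AE \<omega> in M. real_cond_exp M (past_at k) X \<omega> = X \<omega>"
proof -
  interpret finite_measure_subalgebra M "past_at k" by (rule finite_measure_subalgebra_past)
  show ?thesis using assms by (rule real_cond_exp_F_meas)
qed

lemma real_cond_exp_past_zero: "AE \<omega> in M. real_cond_exp M (past_at k) (\<lambda>_. 0) \<omega> = 0"
  by (rule real_cond_exp_past) simp_all

lemma AE_all_workers:
  assumes "\<And>i. i \<in> {1..n} \<Longrightarrow> AE \<omega> in M. P i \<omega>"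
  shows "AE \<omega> in M. \<forall>i\<in>{1..n}. P i \<omega>"
  using assms by (intro AE_finite_allI) simp_all

lemma avg_cond_exp_g_sq_le:
  "AE \<omega> in M. avg n (\<lambda>i. (norm (vec_cond_exp M (past_at k) (g i k) \<omega>))\<^sup>2) \<le> 2 * L * gap k \<omega>"
proof -
  have "AE \<omega> in M. \<forall>i\<in>{1..n}. vec_cond_exp M (past_at k) (g i k) \<omega> = g i k \<omega>"
    by (intro AE_all_workers cond_exp_g)
  then show ?thesis
    using AE_space
  proof eventually_elim
    case (elim \<omega>)
    then have "avg n (\<lambda>i. (norm (vec_cond_exp M (past_at k) (g i k) \<omega>))\<^sup>2) = avg n (\<lambda>i. (norm (g i k \<omega>))\<^sup>2)"
      by (intro avg_cong) simp
    then show ?case using avg_g_sq_le elim(2) by simp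
  qed
qed

lemma conditional_noise_zero:
  fixes k
  assumes i: "i \<in> {1..n}"
  defines "N \<equiv> \<lambda>\<omega>. (norm (g i k \<omega> - vec_cond_exp M (past_at k) (g i k) \<omega>))\<^sup>2"
  shows "integrable M N" "AE \<omega> in M. real_cond_exp M (past_at k) N \<omega> = 0"
proof -
  interpret finite_measure_subalgebra M "past_at k" by (rule finite_measure_subalgebra_past)
  have [measurable]: "g i k \<in> borel_measurable M"
    by (rule measurable_past_imp[OF g_measurable_past[OF i]])
  have N [measurable]: "N \<in> borel_measurable M"
    unfolding N_def vec_cond_exp_def by measurable
  have zero: "AE \<omega> in M. N \<omega> = 0"
    using cond_exp_g[OF i, of k] by eventually_elim (simp add: N_def)
  show "integrable M N"
    using integrable_cong_AE[OF N _ zero] by simp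
  have "AE \<omega> in M. real_cond_exp M (past_at k) N \<omega> = real_cond_exp M (past_at k) (\<lambda>_. 0) \<omega>"
    by (rule real_cond_exp_cong[OF zero N]) simp
  then show "AE \<omega> in M. real_cond_exp M (past_at k) N \<omega> = 0"
    using real_cond_exp_past_zero[of k] by eventually_elim simp
qed

lemma avg_conditional_noise_zero:
  "AE \<omega> in M. avg n (\<lambda>i. real_cond_exp M (past_at k)
      (\<lambda>\<omega>'. (norm (g i k \<omega>' - vec_cond_exp M (past_at k) (g i k) \<omega>'))\<^sup>2) \<omega>) = 0"
proof -
  have "AE \<omega> in M. \<forall>i\<in>{1..n}. real_cond_exp M (past_at k)
      (\<lambda>\<omega>'. (norm (g i k \<omega>' - vec_cond_exp M (past_at k) (g i k) \<omega>'))\<^sup>2) \<omega> = 0"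
    by (intro AE_all_workers conditional_noise_zero(2))
  then show ?thesis
    by eventually_elim (simp add: avg_def)
qed

lemma cond_exp_gmean_sq_le:
  "AE \<omega> in M. real_cond_exp M (past_at k) (\<lambda>\<omega>'. (norm (gmean k \<omega>'))\<^sup>2) \<omega> \<le> 2 * L * gap k \<omega>"
proof -
  have "(\<lambda>\<omega>. (norm (gmean k \<omega>))\<^sup>2) \<in> borel_measurable (past_at k)"
    using gmean_measurable_past[of k] by measurable
  with sq_integrableD(2)[OF gmean_sq_integrable]
  have "AE \<omega> in M. real_cond_exp M (past_at k) (\<lambda>\<omega>'. (norm (gmean k \<omega>'))\<^sup>2) \<omega> = (norm (gmean k \<omega>))\<^sup>2"
    by (rule real_cond_exp_past)
  then show ?thesis
    using AE_space by eventually_elim (simp add: gmean_sq_le)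
qed

lemma weighted_emean_le:
  "3 * L * (\<Sum>k=0..K. ec_weight \<eta> k * (LINT \<omega>|M. (norm (emean k \<omega>))\<^sup>2))
    \<le> 1 / 4 * (\<Sum>k=0..K. ec_weight \<eta> k * (LINT \<omega>|M. gap k \<omega>))"
proof -
  have "3 * L * (\<Sum>k=0..K. ec_weight \<eta> k * (LINT \<omega>|M. (norm (emean k \<omega>))\<^sup>2))
      \<le> 3 * L * (\<Sum>k=0..K. ec_weight \<eta> k * err k)"
    using L_pos weight_pos emean_sq_le_err by (intro mult_left_mono sum_mono) (auto intro: less_imp_le)
  also note weighted_err_le
  finally show ?thesis .
qed

lemma parametric_assumption_EC_GDstar:
  "parametric_assumption M (past M S n \<xi>) n fm xs L \<mu> \<gamma> x e g (\<lambda>_ _. 0) (\<lambda>_ _. 0)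
    \<lparr> cA = L, cA_t = 0, cA_p = L,
      cB1 = 0, cB2 = 0, cB1_t = 0, cB2_t = 0, cB1_p = 0, cB2_p = 0,
      cC1 = 0, cC2 = 0,
      cD1 = 0, cD1_t = 0, cD1_p = 0, cD2 = 0, cD3 = 0,
      cF1 = 0, cF2 = 0, cG = 0, crho1 = 1, crho2 = 1 \<rparr>"
  unfolding parametric_assumption_def Let_def ec_constants.simps ec_eta_eq gap_def[symmetric]
proof (intro conjI allI ballI)
  fix k
  show "integrable M (gmean k)"
    by (rule sq_integrable_imp_integrable[OF gmean_sq_integrable])
  show "AE \<omega> in M. vec_cond_exp M (past_at k) (gmean k) \<omega> = grad fm (x k \<omega>)"
    by (rule cond_exp_gmean)
  show "integrable M (g i k)" if "i \<in> {1..n}" for i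
    by (rule sq_integrable_imp_integrable[OF g_sq_integrable[OF that]])
  show "integrable M (\<lambda>\<omega>. (norm (g i k \<omega> - vec_cond_exp M (past_at k) (g i k) \<omega>))\<^sup>2)" if "i \<in> {1..n}" for i
    by (rule conditional_noise_zero(1)[OF that])
  show "AE \<omega> in M. avg n (\<lambda>i. (norm (vec_cond_exp M (past_at k) (g i k) \<omega>))\<^sup>2)
      \<le> 2 * L * gap k \<omega> + 0 * 0 + 0 * 0 + 0"
    using avg_cond_exp_g_sq_le by simp
  show "AE \<omega> in M. avg n (\<lambda>i. real_cond_exp M (past_at k)
        (\<lambda>\<omega>'. (norm (g i k \<omega>' - vec_cond_exp M (past_at k) (g i k) \<omega>'))\<^sup>2) \<omega>)
      \<le> 2 * 0 * gap k \<omega> + 0 * 0 + 0 * 0 + 0"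
    using avg_conditional_noise_zero[of k] by eventually_elim simp
  show "integrable M (\<lambda>\<omega>. (norm (gmean k \<omega>))\<^sup>2)"
    by (rule sq_integrableD(2)[OF gmean_sq_integrable])
  show "AE \<omega> in M. real_cond_exp M (past_at k) (\<lambda>\<omega>'. (norm (gmean k \<omega>'))\<^sup>2) \<omega>
      \<le> 2 * L * gap k \<omega> + 0 * 0 + 0 * 0 + 0"
    using cond_exp_gmean_sq_le by simp
  show "AE \<omega> in M. real_cond_exp M (past_at k) (\<lambda>_. 0) \<omega>
      \<le> (1 - 1) * 0 + 2 * 0 * gap k \<omega> + 0 * 1 * 0 + 0"
    using real_cond_exp_past_zero[of k] by eventually_elim simp
  show "AE \<omega> in M. real_cond_exp M (past_at k) (\<lambda>_. 0) \<omega> \<le> (1 - 1) * 0 + 2 * 0 * gap k \<omega>"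
    using real_cond_exp_past_zero[of k] by eventually_elim simp
  show "integrable M (\<lambda>\<omega>. (norm (emean k \<omega>))\<^sup>2)"
    by (rule sq_integrableD(2)[OF emean_sq_integrable])
  show "integrable M (gap k)"
    by (rule gap_integrable)
next
  fix K
  show "AE \<omega> in M. 3 * L * (\<Sum>k=0..K. ec_weight \<eta> k * (LINT \<omega>'|M. (norm (emean k \<omega>'))\<^sup>2))
      \<le> 1 / 4 * (\<Sum>k=0..K. ec_weight \<eta> k * (LINT \<omega>'|M. gap k \<omega>'))
        + 0 * 0 + 0 * 0 + \<gamma> * 0 * ec_weight_sum \<eta> K"
    using weighted_emean_le by simp
qed simp_all

end

theorem theoremJ3:
  fixes M :: "'w measure" and S :: "'s measure"
    and n :: nat and f :: "nat \<Rightarrow> 'a::euclidean_space \<Rightarrow> real"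
    and fm :: "'a \<Rightarrow> real"
    and xs x0 :: 'a and L \<mu> \<gamma> \<delta> \<eta> :: real
    and C :: "'s \<Rightarrow> 'a \<Rightarrow> 'a" and \<xi> :: "nat \<Rightarrow> nat \<Rightarrow> 'w \<Rightarrow> 's"
    and x :: "nat \<Rightarrow> 'w \<Rightarrow> 'a" and e g v :: "nat \<Rightarrow> nat \<Rightarrow> 'w \<Rightarrow> 'a"
  assumes "prob_space M" and "n \<ge> 1" and "L > 0" and "\<mu> \<ge> 0"
    and fm: "fm = (\<lambda>y. avg n (\<lambda>i. f i y))"
    and "\<And>i. i \<in> {1..n} \<Longrightarrow> convex_on UNIV (f i)"
    and "\<And>i. i \<in> {1..n} \<Longrightarrow> L_smooth L (f i)"
    and "quasi_strongly_convex \<mu> fm xs"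
    and "compressor \<delta> S C" and "fresh_seeds M S n \<xi>"
    and "0 < \<gamma>" and "\<gamma> \<le> \<delta> / (8 * L * sqrt 3)"
    and "EC_GDstar M n f xs x0 \<gamma> C \<xi> x e g v"
    and eta: "\<eta> = ec_eta \<gamma> \<mu> 1 1"
  shows "parametric_assumption M (past M S n \<xi>) n fm xs L \<mu> \<gamma> x e g (\<lambda>_ _. 0) (\<lambda>_ _. 0)
           \<lparr> cA = L, cA_t = 0, cA_p = L,
             cB1 = 0, cB2 = 0, cB1_t = 0, cB2_t = 0, cB1_p = 0, cB2_p = 0,
             cC1 = 0, cC2 = 0,
             cD1 = 0, cD1_t = 0, cD1_p = 0, cD2 = 0, cD3 = 0,
             cF1 = 0, cF2 = 0, cG = 0, crho1 = 1, crho2 = 1 \<rparr>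
         \<and> (\<forall>K. integrable M (\<lambda>\<omega>. fm (weighted_iterate \<eta> x K \<omega>) - fm xs) \<and>
              (\<mu> > 0 \<longrightarrow>
                 (LINT \<omega>|M. fm (weighted_iterate \<eta> x K \<omega>) - fm xs)
                   \<le> (1 - \<gamma> * \<mu> / 2) ^ K * (4 * (norm (x0 - xs))\<^sup>2 / \<gamma>)) \<and>
              (\<mu> = 0 \<and> K > 0 \<longrightarrow>
                 (LINT \<omega>|M. fm (weighted_iterate \<eta> x K \<omega>) - fm xs)
                   \<le> 4 * (norm (x0 - xs))\<^sup>2 / (real K * \<gamma>)))"
proof -
  interpret run: ec_gdstar_run M S n f fm xs x0 L \<mu> \<gamma> \<delta> C \<xi> x e g v
    using assms(1-13) by (intro ec_gdstar_run.intro ec_gdstar_run_axioms.intro)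
  have \<eta>: "\<eta> = run.\<eta>"
    using eta run.ec_eta_eq by simp
  show ?thesis
  proof (intro conjI allI impI)
    fix K
    show "integrable M (\<lambda>\<omega>. fm (weighted_iterate \<eta> x K \<omega>) - fm xs)"
      unfolding \<eta> by (rule run.weighted_iterate_gap_integrable)
    show "(LINT \<omega>|M. fm (weighted_iterate \<eta> x K \<omega>) - fm xs)
        \<le> (1 - \<gamma> * \<mu> / 2) ^ K * (4 * (norm (x0 - xs))\<^sup>2 / \<gamma>)"
      using run.linear_rate[of K] unfolding \<eta> run.\<eta>_def .
    show "(LINT \<omega>|M. fm (weighted_iterate \<eta> x K \<omega>) - fm xs) \<le> 4 * (norm (x0 - xs))\<^sup>2 / (real K * \<gamma>)"
      if "\<mu> = 0 \<and> K > 0"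
      unfolding \<eta> using that by (intro run.sublinear_rate) auto
  qed (rule run.parametric_assumption_EC_GDstar)
qed

end
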